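(* The positive definite quadratic form $$Q_7^c=\begin{pmatrix}12&1&1&1&1&1&5\\1&12&1&1&1&1&5\\1&1&12&1&1&1&5\\1&1&1&12&1&1&5\\1&1&1&1&12&1&5\\1&1&1&1&1&12&-6\\5&5&5&5&5&-6&14\end{pmatrix}$$ is a locally optimal solution to the lattice covering problem, lying in the interior of its secondary cone. Its inhomogeneous minimum is $\mu(Q_7^c)=\frac{15}{2}$, its determinant is $\det Q_7^c=2\cdot 11^6$, so that $\Theta(Q_7^c)\approx 2.900024$.
   Context: For a positive definite quadratic form (PQF) $Q$, i.e. a positive definite real symmetric $d\times d$ matrix with $Q[x]=x^tQx$, the inhomogeneous minimum is $\mu(Q)=\max_{x\in\mathbb{R}^d}\min_{v\in\mathbb{Z}^d}Q[x-v]$, and $\Theta(Q)=\sqrt{\mu(Q)^d/\det Q}\cdot\kappa_d$, with $\kappa_d$ the volume of the $d$-dimensional unit ball. $Q$ is a locally optimal solution to the lattice covering problem if $Q$ is a local minimum of $\Theta$ on the open cone of all PQFs in $d$ variables. A polytope $\mathrm{conv}\{v_1,\dots,v_n\}$ with $v_i\in\mathbb{Z}^d$ is a Delone polytope of $Q$ if there are $c\in\mathbb{R}^d$, $r\in\mathbb{R}$ with $Q[v_i-c]=r^2$ for all $i$ and $Q[v-c]>r^2$ for all other $v\in\mathbb{Z}^d$; $\mathrm{Del}(Q)$ is the set of all Delone polytopes of $Q$. "$Q$ lies in the interior of its secondary cone" means that $\mathrm{Del}(Q)$ is a triangulation (consists of simplices only), so that $Q$ lies in the full-dimensional open cone $\mathbf{\Delta}(\mathrm{Del}(Q))=\{Q'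 \text{ a PQF}:\mathrm{Del}(Q')=\mathrm{Del}(Q)\}$. *)

theory Defs
  imports "HOL-Analysis.Analysis"
begin

definition quad_form :: "real^'n^'n \<Rightarrow> real^'n \<Rightarrow> real" where
  "quad_form Q x = x \<bullet> (Q *v x)"

definition pqf :: "real^'n^'n \<Rightarrow> bool" where
  "pqf Q \<longleftrightarrow> transpose Q = Q \<and> (\<forall>x. x \<noteq> 0 \<longrightarrow> quad_form Q x > 0)"

definition int_lattice :: "(real^'n) set" where
  "int_lattice = {v. \<forall>i. v $ i \<in> \<int>}"

(* For a PQF the supremum and the infima are finite and attained (the function of x is
   periodic under the integer lattice), so they are the maximum and the minima. *)
definition inhom_min :: "real^'n^'n \<Rightarrow> real" where
  "inhom_min Q = (SUP x. INF v\<in>int_lattice. quad_form Q (x - v))"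

definition covering_density :: "real^'n^'n \<Rightarrow> real" where
  "covering_density Q =
     sqrt (inhom_min Q ^ CARD('n) / det Q) * measure lborel (cball (0 :: real^'n) 1)"

definition locally_optimal_covering :: "real^'n^'n \<Rightarrow> bool" where
  "locally_optimal_covering Q \<longleftrightarrow> pqf Q \<and>
     (\<forall>\<^sub>F Q' in at Q within {Q'. pqf Q'}. covering_density Q \<le> covering_density Q')"

(* Delone polytopes of every dimension occur here, from single lattice points upwards; the
   empty polytope is excluded. *)
definition Delone :: "real^'n^'n \<Rightarrow> (real^'n) set set" where
  "Delone Q = {convex hull V | V. V \<noteq> {} \<and> finite V \<and> V \<subseteq> int_lattice \<and>
     (\<exists>c r. (\<forall>v\<in>V. quad_form Q (v - c) = r\<^sup>2) \<and>
            (\<forall>v\<in>int_lattice - V. quad_form Q (v - c) > r\<^sup>2))}"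

definition Delone_triangulation :: "real^'n^'n \<Rightarrow> bool" where
  "Delone_triangulation Q \<longleftrightarrow> (\<forall>P\<in>Delone Q. \<exists>k. k simplex P)"

definition secondary_cone :: "(real^'n) set set \<Rightarrow> (real^'n^'n) set" where
  "secondary_cone D = {Q. pqf Q \<and> Delone Q = D}"

(* The interior is taken in the space of symmetric matrices: in the space of all matrices
   the secondary cones have empty interior (unless the dimension is 1). *)
definition in_interior_of_secondary_cone :: "real^'n^'n \<Rightarrow> bool" where
  "in_interior_of_secondary_cone Q \<longleftrightarrow> Delone_triangulation Q \<and>
     Q \<in> (top_of_set {S. transpose S = S}) interior_of (secondary_cone (Delone Q))"

definition Q7c :: "real^7^7" where
  "Q7c = vector
    [vector [12,  1,  1,  1,  1,  1,  5],
     vector [ 1, 12,  1,  1,  1,  1,  5],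
     vector [ 1,  1, 12,  1,  1,  1,  5],
     vector [ 1,  1,  1, 12,  1,  1,  5],
     vector [ 1,  1,  1,  1, 12,  1,  5],
     vector [ 1,  1,  1,  1,  1, 12, -6],
     vector [ 5,  5,  5,  5,  5, -6, 14]]"

end

theory Submission
  imports Defs
begin

text \<open>
  A simplex \<open>W\<close> is Delone for \<open>Q\<close> iff the power of every other lattice point with respect to
  the circumscribed \<open>Q\<close>-sphere of \<open>W\<close> is positive. For a family of unimodular lattice simplices
  closed under translation and under passing to the neighbour across a facet, it suffices to
  check this for the opposite vertex of each neighbour: the simplex minimizing the power of a
  point \<open>x\<close> must contain \<open>x\<close>, because crossing a facet that separates it from \<open>x\<close> would
  decrease the power. These are finitely many strict inequalities, linear in \<open>Q\<close>, so the Delone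
  subdivision is constant near \<open>Q\<close>.

  \<open>Q7c\<close> is invariant under \<open>S\<^sub>7 \<times> {\<plusminus>1}\<close>, and up to this group and translations its Delone
  subdivision has three maximal simplices A, B, C. For any point \<open>c\<close> with barycentric coordinates
  \<open>\<lambda>\<^sub>w\<close> in \<open>W\<close>, the squared circumradius of \<open>W\<close> is at least \<open>\<Sum>\<^sub>w \<lambda>\<^sub>w Q[w - c]\<close>, which is linear
  in \<open>Q\<close>. Averaging these bounds over the orbits of A and C, taken at their circumcentres with
  respect to \<open>Q7c\<close> and with weights 3/4 and 1/4, gives a multiple of the trace of
  \<open>Q Q7c\<^sup>-\<^sup>1\<close>; Hadamard's inequality and the inequality of arithmetic and geometric
  means then bound \<open>inhom_min Q ^ 7 / det Q\<close> from below by its value at \<open>Q7c\<close>.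
\<close>

section \<open>Barycentric coordinates\<close>

definition affine_fun :: "('a::real_vector \<Rightarrow> real) \<Rightarrow> bool" where
  "affine_fun f \<longleftrightarrow> (\<exists>l k. linear l \<and> f = (\<lambda>x. l x + k))"

lemma affine_fun_linear: "linear l \<Longrightarrow> affine_fun l"
  unfolding affine_fun_def by (intro exI[of _ l] exI[of _ 0]) auto

lemma affine_fun_const [simp]: "affine_fun (\<lambda>x. k)"
  unfolding affine_fun_def by (intro exI[of _ "\<lambda>x. 0"] exI[of _ k]) (auto simp: linear_iff)

lemma affine_fun_add: 
  assumes "affine_fun f" "affine_fun g" shows "affine_fun (\<lambda>x. f x + g x)"
proof -
  obtain l k l' k' where "linear l" "f = (\<lambda>x. l x + k)" "linear l'" "g = (\<lambda>x. l' x + k')"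
    using assms by (auto simp: affine_fun_def)
  then show ?thesis unfolding affine_fun_def
    by (intro exI[of _ "\<lambda>x. l x + l' x"] exI[of _ "k+k'"]) (auto simp: linear_compose_add)
qed

lemma affine_fun_cmult: 
  assumes "affine_fun f" shows "affine_fun (\<lambda>x. c * f x)"
proof -
  obtain l k where "linear l" "f = (\<lambda>x. l x + k)"
    using assms by (auto simp: affine_fun_def)
  then show ?thesis unfolding affine_fun_def
    by (intro exI[of _ "\<lambda>x. c * l x"] exI[of _ "c * k"])
       (auto simp: linear_iff algebra_simps)
qed

lemma affine_fun_diff: 
  assumes "affine_fun f" "affine_fun g" shows "affine_fun (\<lambda>x. f x - g x)"
  using affine_fun_add[OF assms(1) affine_fun_cmult[OF assms(2), of "-1"]] by simp

lemma affine_fun_sum: 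
  assumes "\<And>i. i \<in> I \<Longrightarrow> affine_fun (f i)" shows "affine_fun (\<lambda>x. \<Sum>i\<in>I. f i x)"
  using assms by (induction I rule: infinite_finite_induct) (auto intro!: affine_fun_add)

lemma affine_fun_compose:
  assumes "affine_fun f" "linear h" shows "affine_fun (\<lambda>x. f (h x + t))"
proof -
  obtain l k where lk: "linear l" "f = (\<lambda>x. l x + k)"
    using assms by (auto simp: affine_fun_def)
  have "linear (\<lambda>x. l (h x))" using linear_compose[OF assms(2) lk(1)] by (simp add: o_def)
  moreover have "f (h x + t) = l (h x) + (l t + k)" for x 
    using lk by (simp add: linear_add)
  ultimately show ?thesis unfolding affine_fun_def 
    by (intro exI[of _ "\<lambda>x. l (h x)"] exI[of _ "l t + k"]) auto
qed

text \<open>A frame is the vertex set of a full-dimensional simplex, encoded by its dual affine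
  functions. This form avoids dimension counts and also gives coordinates of points outside the
  simplex.\<close>

definition is_frame :: "'a::real_vector set \<Rightarrow> ('a \<Rightarrow> 'a \<Rightarrow> real) \<Rightarrow> bool" where
  "is_frame W b \<longleftrightarrow> finite W \<and> (\<forall>w\<in>W. affine_fun (b w)) \<and>
     (\<forall>w\<in>W. \<forall>v\<in>W. b w v = of_bool (w = v)) \<and>
     (\<forall>x. (\<Sum>w\<in>W. b w x) = 1 \<and> (\<Sum>w\<in>W. b w x *\<^sub>R w) = x)"

definition frame :: "'a::real_vector set \<Rightarrow> bool" where
  "frame W \<longleftrightarrow> (\<exists>b. is_frame W b)"

definition bary :: "'a::real_vector set \<Rightarrow> 'a \<Rightarrow> 'a \<Rightarrow> real" where
  "bary W = (SOME b. is_frame W b)"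

lemma frameD: "frame W \<Longrightarrow> is_frame W (bary W)"
  unfolding frame_def by (metis bary_def someI_ex)

text \<open>Affine functions commute with combinations whose coefficients sum to 1.\<close>

lemma frame_interpolate:
  assumes "is_frame W b" "affine_fun f"
  shows "f x = (\<Sum>w\<in>W. b w x * f w)"
proof -
  obtain l k where lk: "linear l" "f = (\<lambda>x. l x + k)"
    using assms by (auto simp: affine_fun_def)
  have "f x = l (\<Sum>w\<in>W. b w x *\<^sub>R w) + k * (\<Sum>w\<in>W. b w x)"
    using assms(1) lk unfolding is_frame_def by simp
  also have "\<dots> = (\<Sum>w\<in>W. b w x * l w) + (\<Sum>w\<in>W. b w x * k)"
    by (simp add: linear_sum[OF lk(1)] linear_scale[OF lk(1)] sum_distrib_left mult.commute)
  finally show ?thesis using lk by (simp add: algebra_simps sum.distrib)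
qed

text \<open>Barycentric coordinates are unique: interpolating \<open>bary W w\<close> with the
  coordinates \<open>b\<close> returns \<open>b w\<close>. So the choice in \<open>bary\<close> can
  be replaced by any explicit coordinates.\<close>

lemma bary_eq:
  assumes "is_frame W b" "w \<in> W" shows "bary W w x = b w x"
proof -
  have W: "is_frame W (bary W)" using assms(1) by (intro frameD) (auto simp: frame_def)
  then have a: "affine_fun (bary W w)" using assms unfolding is_frame_def by blast
  have "bary W w x = (\<Sum>v\<in>W. b v x * bary W w v)" by (rule frame_interpolate[OF assms(1) a])
  also have "\<dots> = (\<Sum>v\<in>W. b v x * of_bool (w = v))"
    using W assms by (intro sum.cong) (auto simp: is_frame_def)
  also have "\<dots> = b w x"
    using assms by (simp add: is_frame_def)
  finally show ?thesis .
qed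

lemma frame_indexed:
  fixes w :: "nat \<Rightarrow> 'a::real_vector"
  assumes aff: "\<And>i. i < n \<Longrightarrow> affine_fun (\<beta> i)"
    and dual: "\<And>i j. i < n \<Longrightarrow> j < n \<Longrightarrow> \<beta> i (w j) = of_bool (i = j)"
    and sum1: "\<And>x. (\<Sum>i<n. \<beta> i x) = 1" and sumx: "\<And>x. (\<Sum>i<n. \<beta> i x *\<^sub>R w i) = x"
  shows "frame (w ` {..<n})" "i < n \<Longrightarrow> bary (w ` {..<n}) (w i) x = \<beta> i x" "inj_on w {..<n}"
proof -
  show inj: "inj_on w {..<n}"
  proof (rule inj_onI)
    fix i j assume "i \<in> {..<n}" "j \<in> {..<n}" "w i = w j"
    then show "i = j" using dual[of i i] dual[of i j] by (cases "i = j") auto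
  qed
  have inv: "inv_into {..<n} w (w i) = i" if "i < n" for i using inj that by simp
  have f: "is_frame (w ` {..<n}) (\<lambda>v. \<beta> (inv_into {..<n} w v))"
    unfolding is_frame_def
  proof (intro conjI ballI allI)
    fix x
    show "(\<Sum>v\<in>w ` {..<n}. \<beta> (inv_into {..<n} w v) x) = 1"
      by (simp add: sum.reindex[OF inj] inv sum1)
    show "(\<Sum>v\<in>w ` {..<n}. \<beta> (inv_into {..<n} w v) x *\<^sub>R v) = x"
      by (simp add: sum.reindex[OF inj] inv sumx)
  qed (auto simp: inv aff dual inj_on_eq_iff[OF inj])
  then show "frame (w ` {..<n})" unfolding frame_def by blast
  show "bary (w ` {..<n}) (w i) x = \<beta> i x" if "i < n"
    using bary_eq[OF f, of "w i" x] that by (simp add: inv)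
qed

lemma frame_finite: "frame W \<Longrightarrow> finite W"
  by (drule frameD) (simp add: is_frame_def)

lemma affine_fun_bary: "frame W \<Longrightarrow> w \<in> W \<Longrightarrow> affine_fun (bary W w)"
  by (drule frameD) (simp add: is_frame_def)

lemma bary_vertex: "frame W \<Longrightarrow> w \<in> W \<Longrightarrow> v \<in> W \<Longrightarrow> bary W w v = of_bool (w = v)"
  by (drule frameD) (simp add: is_frame_def)

lemma sum_bary: "frame W \<Longrightarrow> (\<Sum>w\<in>W. bary W w x) = 1"
  by (drule frameD) (simp add: is_frame_def)

lemma sum_bary_scaleR: "frame W \<Longrightarrow> (\<Sum>w\<in>W. bary W w x *\<^sub>R w) = x"
  by (drule frameD) (simp add: is_frame_def)

lemma is_frame_image:
  fixes h h' :: "'a::real_vector \<Rightarrow> 'a"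
  assumes W: "is_frame W b" and h: "linear h" and h': "linear h'"
    and inv: "\<And>x. h' (h x) = x" "\<And>x. h (h' x) = x"
  shows "is_frame ((\<lambda>x. h x + t) ` W) (\<lambda>w x. b (h' (w - t)) (h' (x - t)))"
proof -
  define g where "g = (\<lambda>x. h x + t)"
  define g' where "g' = (\<lambda>x. h' (x - t))"
  have gg: "g' (g x) = x" "g (g' x) = x" for x by (auto simp: g_def g'_def inv)
  have inj: "inj_on g W" by (metis gg(1) inj_onI)
  have g'alt: "g' x = h' x + h' (- t)" for x
    unfolding g'_def using linear_add[OF h', of x "-t"] by simp
  have "is_frame (g ` W) (\<lambda>w x. b (g' w) (g' x))"
    unfolding is_frame_def
  proof (intro conjI ballI allI)
    show "finite (g ` W)" using W by (simp add: is_frame_def)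
  next
    fix w assume "w \<in> g ` W"
    then have "g' w \<in> W" using gg by auto
    then have "affine_fun (b (g' w))" using W by (simp add: is_frame_def)
    from affine_fun_compose[OF this h', of "h' (-t)"] show "affine_fun (\<lambda>x. b (g' w) (g' x))"
      by (simp add: g'alt[symmetric])
  next
    fix w v assume "w \<in> g ` W" "v \<in> g ` W"
    then show "b (g' w) (g' v) = of_bool (w = v)" using W gg by (auto simp: is_frame_def)
  next
    fix x
    show "(\<Sum>w\<in>g ` W. b (g' w) (g' x)) = 1"
      using W by (simp add: sum.reindex[OF inj] gg is_frame_def)
    have "(\<Sum>w\<in>g ` W. b (g' w) (g' x) *\<^sub>R w) = (\<Sum>w\<in>W. b w (g' x) *\<^sub>R (h w + t))"
      by (simp add: sum.reindex[OF inj] gg, simp add: g_def)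
    also have "\<dots> = h (\<Sum>w\<in>W. b w (g' x) *\<^sub>R w) + (\<Sum>w\<in>W. b w (g' x)) *\<^sub>R t"
      by (simp add: linear_sum[OF h] linear_scale[OF h] scaleR_add_right sum.distrib scaleR_sum_left)
    also have "\<dots> = h (g' x) + t" using W by (simp add: is_frame_def)
    also have "\<dots> = x" using gg(2)[of x] by (simp add: g_def)
    finally show "(\<Sum>w\<in>g ` W. b (g' w) (g' x) *\<^sub>R w) = x" .
  qed
  then show ?thesis by (simp add: g_def g'_def)
qed

lemma frame_image:
  fixes h h' :: "'a::real_vector \<Rightarrow> 'a"
  assumes W: "frame W" and h: "linear h" and h': "linear h'"
    and inv: "\<And>x. h' (h x) = x" "\<And>x. h (h' x) = x"
  shows "frame ((\<lambda>x. h x + t) ` W)"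
    and "w \<in> W \<Longrightarrow> bary ((\<lambda>x. h x + t) ` W) (h w + t) (h x + t) = bary W w x"
proof -
  note * = is_frame_image[OF frameD[OF W] h h' inv, of t]
  show "frame ((\<lambda>x. h x + t) ` W)" unfolding frame_def by (rule exI, rule *)
  show "bary ((\<lambda>x. h x + t) ` W) (h w + t) (h x + t) = bary W w x" if "w \<in> W"
    using bary_eq[OF *, of "h w + t" "h x + t"] that by (simp add: inv)
qed

lemma frame_translate:
  assumes "frame (W :: 'a::real_vector set)"
  shows "frame ((+) t ` W)"
    and "w \<in> W \<Longrightarrow> bary ((+) t ` W) (t + w) (t + x) = bary W w x"
proof -
  have *: "linear (\<lambda>x::'a. x)" by (rule linear_ident)
  have e: "(+) t ` W = (\<lambda>x. x + t) ` W" by (auto simp: add.commute)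
  show "frame ((+) t ` W)" unfolding e by (rule frame_image(1)[OF assms * *]) auto
  show "bary ((+) t ` W) (t + w) (t + x) = bary W w x" if "w \<in> W"
    unfolding e add.commute[of t] by (rule frame_image(2)[OF assms * * _ _ that]) auto
qed

text \<open>Applying the affine function \<open>bary W v\<close> to an affine relation among the
  vertices isolates the coefficient of \<open>v\<close>.\<close>

lemma frame_affine_independent:
  assumes "frame W" shows "\<not> affine_dependent W"
proof
  assume "affine_dependent W"
  then obtain U where U: "sum U W = 0" "\<exists>v\<in>W. U v \<noteq> 0" "(\<Sum>v\<in>W. U v *\<^sub>R v) = 0"
    using affine_dependent_explicit_finite[OF frame_finite[OF assms]] by metis
  then obtain v where v: "v \<in> W" "U v \<noteq> 0" by blast
  obtain l k where lk: "linear l" "bary W v = (\<lambda>x. l x + k)"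
    using affine_fun_bary[OF assms v(1)] by (auto simp: affine_fun_def)
  have "(\<Sum>w\<in>W. U w * bary W v w) = l (\<Sum>w\<in>W. U w *\<^sub>R w) + k * sum U W"
    by (simp add: lk(2) linear_sum[OF lk(1)] linear_scale[OF lk(1)] sum_distrib_left 
        algebra_simps sum.distrib)
  also have "\<dots> = 0" using U linear_0[OF lk(1)] by simp
  finally have "(\<Sum>w\<in>W. U w * bary W v w) = 0" .
  moreover have "(\<Sum>w\<in>W. U w * bary W v w) = (\<Sum>w\<in>W. U w * of_bool (v = w))"
    using bary_vertex[OF assms v(1)] by simp
  ultimately show False using v frame_finite[OF assms] by simp
qed

section \<open>Positive definite forms and the integer lattice\<close>

lemma quad_form_add:
  assumes "transpose Q = Q"
  shows "quad_form Q (x + y) = quad_form Q x + 2 * (x \<bullet> (Q *v y)) + quad_form Q y"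
proof -
  have "y \<bullet> (Q *v x) = x \<bullet> (Q *v y)"
    using dot_lmul_matrix[of y Q x] assms 
    by (metis inner_commute transpose_matrix_vector)
  then show ?thesis by (simp add: quad_form_def matrix_vector_right_distrib inner_add algebra_simps)
qed

lemma quad_form_scaleR: "quad_form Q (c *\<^sub>R x) = c\<^sup>2 * quad_form Q x"
  by (simp add: quad_form_def matrix_vector_mult_scaleR power2_eq_square)

lemma quad_form_minus: "quad_form Q (- x) = quad_form Q x"
  using quad_form_scaleR[of Q "-1" x] by simp

lemma quad_form_0 [simp]: "quad_form Q 0 = 0"
  by (simp add: quad_form_def)

lemma affine_fun_quad_form_translate:
  assumes "transpose Q = Q"
  shows "affine_fun (\<lambda>x. quad_form Q (x + t) - quad_form Q x)"
proof -
  have "linear (\<lambda>x. 2 * (x \<bullet> (Q *v t)))"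
    by (auto simp: linear_iff inner_add algebra_simps)
  then have "affine_fun (\<lambda>x. 2 * (x \<bullet> (Q *v t)) + quad_form Q t)"
    unfolding affine_fun_def by blast
  then show ?thesis by (simp add: quad_form_add[OF assms])
qed

lemma pqf_nonneg: "pqf Q \<Longrightarrow> quad_form Q x \<ge> 0"
  by (cases "x = 0") (auto simp: pqf_def intro: less_imp_le)

lemma pqf_sym: "pqf Q \<Longrightarrow> transpose Q = Q"
  by (simp add: pqf_def)

lemma pqf_surj:
  fixes Q :: "real^'n^'n"
  assumes Q: "pqf Q"
  shows "surj ((*v) Q)"
proof -
  have "inj ((*v) Q)"
  proof (subst linear_injective_0)
    show "linear ((*v) Q)" by simp
    show "\<forall>x. Q *v x = 0 \<longrightarrow> x = 0"
    proof (intro allI impI, rule ccontr)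
      fix x assume "Q *v x = 0" "x \<noteq> 0"
      then have "quad_form Q x > 0" "quad_form Q x = 0" using Q by (auto simp: pqf_def quad_form_def)
      then show False by simp
    qed
  qed
  then show ?thesis by (intro linear_injective_imp_surjective) auto
qed

text \<open>The linear part of \<open>f\<close> is the inner product with a vector \<open>a\<close>;
  surjectivity of \<open>Q\<close> gives the centre \<open>c\<close> with
  \<open>Q c = a/2\<close>.\<close>

lemma pqf_complete_square:
  fixes Q :: "real^'n^'n"
  assumes Q: "pqf Q" and f: "affine_fun f"
  obtains c s where "\<And>x. quad_form Q x - f x = quad_form Q (x - c) - s"
proof -
  obtain l k where lk: "linear l" "f = (\<lambda>x. l x + k)" using f by (auto simp: affine_fun_def)
  define a where "a = (\<chi> i. l (axis i 1))"
  have l: "l x = x \<bullet> a" for x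
  proof -
    have "l x = l (\<Sum>i\<in>UNIV. x $ i *\<^sub>R axis i 1)" 
      using basis_expansion[of x] by (simp add: scalar_mult_eq_scaleR)
    also have "\<dots> = (\<Sum>i\<in>UNIV. x $ i * l (axis i 1))"
      by (simp add: linear_sum[OF lk(1)] linear_scale[OF lk(1)])
    finally show ?thesis by (simp add: inner_vec_def a_def)
  qed
  obtain c where c: "Q *v c = (1/2) *\<^sub>R a" using pqf_surj[OF Q] by (metis surjD)
  have "quad_form Q x - f x = quad_form Q (x - c) - (quad_form Q c + k)" for x
  proof -
    have "quad_form Q (x - c) = quad_form Q x - 2 * (x \<bullet> (Q *v c)) + quad_form Q c"
      using quad_form_add[OF pqf_sym[OF Q], of x "-c"] 
      by (simp add: quad_form_minus linear_neg[OF matrix_vector_mul_linear])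
    then show ?thesis using c by (simp add: lk l)
  qed
  then show ?thesis using that by blast
qed

lemma finite_bounded_int_lattice: "finite {v::real^'n. v \<in> int_lattice \<and> norm v \<le> K}"
proof -
  let ?S = "{z::real. z \<in> \<int> \<and> \<bar>z\<bar> \<le> K}"
  have "finite ?S" by (rule finite_abs_int_segment)
  then have "finite (PiE (UNIV::'n set) (\<lambda>_. ?S))" by (intro finite_PiE) auto
  then have "finite ((\<lambda>f. \<chi> i. f i) ` (PiE (UNIV::'n set) (\<lambda>_. ?S)))" by (rule finite_imageI)
  moreover have "{v::real^'n. v \<in> int_lattice \<and> norm v \<le> K} \<subseteq> (\<lambda>f. \<chi> i. f i) ` (PiE (UNIV::'n set) (\<lambda>_. ?S))"
  proof
    fix v :: "real^'n" assume v: "v \<in> {v. v \<in> int_lattice \<and> norm v \<le> K}"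
    then have "(\<lambda>i. v $ i) \<in> PiE UNIV (\<lambda>_. ?S)"
      using order_trans[OF component_le_norm_cart[of v]] by (auto simp: int_lattice_def PiE_def)
    moreover have "v = (\<chi> i. v $ i)" by (simp add: vec_eq_iff)
    ultimately show "v \<in> (\<lambda>f. \<chi> i. f i) ` (PiE (UNIV::'n set) (\<lambda>_. ?S))" by blast
  qed
  ultimately show ?thesis by (rule finite_subset[rotated])
qed

lemma pqf_coercive:
  fixes Q :: "real^'n^'n"
  assumes "pqf Q"
  obtains m where "m > 0" "\<And>x. quad_form Q x \<ge> m * (norm x)\<^sup>2"
proof -
  let ?S = "sphere (0::real^'n) 1"
  have "continuous_on ?S (quad_form Q)" 
    unfolding quad_form_def by (intro continuous_intros linear_continuous_on) auto
  moreover have "?S \<noteq> {}" by simp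
  ultimately obtain x0 where x0: "x0 \<in> ?S" "\<forall>x\<in>?S. quad_form Q x0 \<le> quad_form Q x"
    using continuous_attains_inf[of ?S "quad_form Q"] by auto
  have "quad_form Q x \<ge> quad_form Q x0 * (norm x)\<^sup>2" for x
  proof (cases "x = 0")
    case False
    then have "quad_form Q ((1 / norm x) *\<^sub>R x) \<ge> quad_form Q x0" using x0 by simp
    then show ?thesis using False by (simp add: quad_form_scaleR field_simps)
  qed simp
  moreover have "quad_form Q x0 > 0"
    using x0(1) assms unfolding pqf_def by (metis norm_zero mem_sphere_0 zero_neq_one)
  ultimately show ?thesis using that by blast
qed

lemma finite_pqf_sublevel:
  assumes Q: "pqf Q"
  shows "finite {v. v \<in> int_lattice \<and> quad_form Q (v - c) \<le> s}"
proof -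
  obtain m where m: "m > 0" "\<And>x. quad_form Q x \<ge> m * (norm x)\<^sup>2" using pqf_coercive[OF Q] by metis
  have "norm v \<le> norm c + sqrt (s / m)" if "quad_form Q (v - c) \<le> s" for v
  proof -
    have "(norm (v - c))\<^sup>2 \<le> s / m" using m(2)[of "v - c"] that m(1) by (simp add: field_simps)
    then have "norm (v - c) \<le> sqrt (s / m)" using real_le_rsqrt by blast
    then show ?thesis using norm_triangle_sub[of v c] by simp
  qed
  then have "{v. v \<in> int_lattice \<and> quad_form Q (v - c) \<le> s} \<subseteq> 
      {v. v \<in> int_lattice \<and> norm v \<le> norm c + sqrt (s / m)}" by blast
  then show ?thesis by (rule finite_subset[OF _ finite_bounded_int_lattice])
qed

lemma int_lattice_add: "v \<in> int_lattice \<Longrightarrow> w \<in> int_lattice \<Longrightarrow> v + w \<in> int_lattice"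
  and int_lattice_diff: "v \<in> int_lattice \<Longrightarrow> w \<in> int_lattice \<Longrightarrow> v - w \<in> int_lattice"
  and int_lattice_0: "0 \<in> int_lattice"
  by (auto simp: int_lattice_def)

text \<open>
  The error of interpolating \<open>Q\<close> affinely on \<open>W\<close>. Completing the square shows that it is the power
  with respect to the circumscribed \<open>Q\<close>-sphere of \<open>W\<close>, but this form needs no centre and is
  linear in \<open>Q\<close>.
\<close>

definition sphere_power :: "real^'n^'n \<Rightarrow> (real^'n) set \<Rightarrow> real^'n \<Rightarrow> real" where
  "sphere_power Q W x = quad_form Q x - (\<Sum>w\<in>W. bary W w x * quad_form Q w)"

lemma sphere_power_vertex: "frame W \<Longrightarrow> w \<in> W \<Longrightarrow> sphere_power Q W w = 0"
  using frame_finite[of W] by (simp add: sphere_power_def bary_vertex)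

lemma affine_fun_sphere_power:
  assumes "frame W"
  shows "affine_fun (\<lambda>x. quad_form Q x - sphere_power Q W x)"
proof -
  have "affine_fun (\<lambda>x. \<Sum>w\<in>W. quad_form Q w * bary W w x)"
    by (intro affine_fun_sum affine_fun_cmult affine_fun_bary assms)
  then show ?thesis by (simp add: sphere_power_def mult.commute)
qed

text \<open>\<open>Q - f\<close> is affine, hence interpolated from its vertex values, which are
  those of \<open>Q\<close>. So the power is the only function that vanishes on \<open>W\<close> and
  differs from \<open>Q\<close> by an affine function.\<close>

lemma sphere_power_eqI:
  assumes W: "frame W" and f: "affine_fun (\<lambda>x. quad_form Q x - f x)" "\<And>w. w \<in> W \<Longrightarrow> f w = 0"
  shows "f x = sphere_power Q W x"
proof -
  have "quad_form Q x - f x = (\<Sum>w\<in>W. bary W w x * (quad_form Q w - f w))"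
    by (rule frame_interpolate[OF frameD[OF W] f(1)])
  then show ?thesis using f(2) by (simp add: sphere_power_def)
qed

lemma sphere_power_translate:
  assumes Q: "transpose Q = Q" and W: "frame W"
  shows "sphere_power Q ((+) t ` W) (t + x) = sphere_power Q W x"
proof -
  have "affine_fun (\<lambda>x. (quad_form Q (x + t) - quad_form Q x) + (quad_form Q x - sphere_power Q W x))"
    by (intro affine_fun_add affine_fun_quad_form_translate affine_fun_sphere_power Q W)
  then have a: "affine_fun (\<lambda>x. quad_form Q (x + t) - sphere_power Q W x)" by simp
  have b: "affine_fun (\<lambda>y. quad_form Q y - sphere_power Q W (y - t))"
    using affine_fun_compose[OF a, of "\<lambda>x. x" "-t"] by (simp add: linear_ident)
  have "sphere_power Q W ((t + x) - t) = sphere_power Q ((+) t ` W) (t + x)"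
    by (rule sphere_power_eqI[OF frame_translate(1)[OF W] b]) (use W sphere_power_vertex in auto)
  then show ?thesis by simp
qed

lemma sphere_power_center:
  assumes "pqf Q" "frame W"
  obtains c s where "\<And>x. sphere_power Q W x = quad_form Q (x - c) - s"
proof -
  obtain c s where "\<And>x. quad_form Q x - (quad_form Q x - sphere_power Q W x) = quad_form Q (x - c) - s"
    using pqf_complete_square[OF assms(1) affine_fun_sphere_power[OF assms(2)]] by metis
  then show ?thesis using that by simp
qed

section \<open>Families of simplices closed under facet neighbours\<close>

text \<open>The difference of the two power functions is affine and vanishes on the common facet, so
  it is a multiple of the coordinate \<open>bary W w\<close>. Its sign beyond the facet is read off
  at \<open>u\<close>.\<close>

lemma sphere_power_flip:
  assumes W: "frame W" and W': "frame (insert u (W - {w}))" and w: "w \<in> W"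
    and u: "bary W w u < 0" "sphere_power Q W u > 0" and x: "bary W w x < 0"
  shows "sphere_power Q (insert u (W - {w})) x < sphere_power Q W x"
proof -
  let ?W' = "insert u (W - {w})"
  define D where "D = (\<lambda>y. sphere_power Q W y - sphere_power Q ?W' y)"
  have "affine_fun (\<lambda>y. (quad_form Q y - sphere_power Q ?W' y) - (quad_form Q y - sphere_power Q W y))"
    by (intro affine_fun_diff affine_fun_sphere_power W W')
  then have aff: "affine_fun D" by (simp add: D_def)
  have D: "D y = bary W w y * D w" for y
  proof -
    have "D y = (\<Sum>v\<in>W. bary W v y * D v)" by (rule frame_interpolate[OF frameD[OF W] aff])
    also have "\<dots> = (\<Sum>v\<in>W. if v = w then bary W v y * D v else 0)"
      by (intro sum.cong refl) (auto simp: D_def sphere_power_vertex W W')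
    finally show ?thesis using w frame_finite[OF W] by simp
  qed
  have "D u > 0" using u W' by (simp add: D_def sphere_power_vertex)
  then have "D w < 0" using D[of u] u(1) by (simp add: zero_less_mult_iff)
  then have "D x > 0" using D[of x] x by (simp add: mult_neg_neg)
  then show ?thesis by (simp add: D_def)
qed

lemma nonneg_integers_sum_1:
  fixes f :: "'a \<Rightarrow> real"
  assumes "finite W" "\<And>w. w \<in> W \<Longrightarrow> f w \<in> \<int>" "\<And>w. w \<in> W \<Longrightarrow> f w \<ge> 0" "sum f W = 1"
  obtains w where "w \<in> W" "\<And>v. v \<in> W \<Longrightarrow> f v = of_bool (v = w)"
proof -
  obtain w where w: "w \<in> W" "f w \<noteq> 0" using assms(4) by (metis sum.neutral zero_neq_one)
  obtain z where z: "f w = of_int z" using assms(2)[OF w(1)] Ints_cases by blast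
  have "f w \<ge> 1" using w(2) assms(3)[OF w(1)] unfolding z by simp
  moreover have s: "f w + sum f (W - {w}) = 1" using assms(1,4) w(1) by (simp add: sum.remove)
  moreover have "sum f (W - {w}) \<ge> 0" using assms(3) by (intro sum_nonneg) auto
  ultimately have "f w = 1" "sum f (W - {w}) = 0" by linarith+
  then have "\<And>v. v \<in> W - {w} \<Longrightarrow> f v = 0"
    using assms(1,3) by (subst (asm) sum_nonneg_eq_0_iff) auto
  then show ?thesis using that[OF w(1)] \<open>f w = 1\<close> by force
qed

text \<open>\<open>R\<close> represents a family of simplices up to lattice translations. Integral
  coordinates of all lattice points express unimodularity: the vertices form an affine basis of the
  lattice.\<close>

locale unimodular_frames =
  fixes R :: "(real^'n) set set"
  assumes finite_R: "finite R" and R_nonempty: "R \<noteq> {}"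
    and frame_R: "W \<in> R \<Longrightarrow> frame W"
    and lattice_R: "W \<in> R \<Longrightarrow> W \<subseteq> int_lattice"
    and unimodular_R: "W \<in> R \<Longrightarrow> w \<in> W \<Longrightarrow> v \<in> int_lattice \<Longrightarrow> bary W w v \<in> \<int>"
begin

definition translates :: "(real^'n) set set" where
  "translates = {(+) t ` W | t W. t \<in> int_lattice \<and> W \<in> R}"

text \<open>The condition \<open>bary W w u < 0\<close> puts \<open>u\<close> beyond the facet
  opposite \<open>w\<close>, and membership in \<open>translates\<close> closes the family under
  facet neighbours. Only the last condition involves \<open>Q\<close>.\<close>

definition locally_Delone :: "real^'n^'n \<Rightarrow> bool" where
  "locally_Delone Q \<longleftrightarrow> (\<forall>W\<in>R. \<forall>w\<in>W. \<exists>u\<in>int_lattice.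
     insert u (W - {w}) \<in> translates \<and> bary W w u < 0 \<and> sphere_power Q W u > 0)"

definition faces :: "(real^'n) set set" where
  "faces = {convex hull V | V W. V \<noteq> {} \<and> V \<subseteq> W \<and> W \<in> translates}"

lemma R_translates: "W \<in> R \<Longrightarrow> W \<in> translates"
  unfolding translates_def using int_lattice_0 by (intro CollectI exI[of _ 0] exI[of _ W]) simp

lemma translates_translate:
  assumes "W \<in> translates" "t \<in> int_lattice" shows "(+) t ` W \<in> translates"
proof -
  obtain s V where "s \<in> int_lattice" "V \<in> R" "W = (+) s ` V" 
    using assms unfolding translates_def by blast
  then have "(+) t ` W = (+) (t + s) ` V" "t + s \<in> int_lattice"
    using assms by (auto simp: image_image add.assoc int_lattice_add)
  then show ?thesis unfolding translates_def using \<open>V \<in> R\<close> by blast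
qed

lemma frame_translates: "W \<in> translates \<Longrightarrow> frame W"
  unfolding translates_def using frame_R frame_translate(1) by blast

lemma lattice_translates: "W \<in> translates \<Longrightarrow> W \<subseteq> int_lattice"
  unfolding translates_def using lattice_R int_lattice_add by blast

lemma unimodular_translates:
  assumes "W \<in> translates" "w \<in> W" "v \<in> int_lattice" shows "bary W w v \<in> \<int>"
proof -
  obtain t V where V: "t \<in> int_lattice" "V \<in> R" "W = (+) t ` V" 
    using assms(1) unfolding translates_def by blast
  then obtain w' where w': "w' \<in> V" "w = t + w'" using assms(2) by blast
  have "bary V w' (v - t) \<in> \<int>" by (rule unimodular_R) (use V w' assms int_lattice_diff in auto)
  then show ?thesis using frame_translate(2)[OF frame_R[OF V(2)] w'(1), of t "v - t"] V w' by simp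
qed

text \<open>The coordinates of \<open>v\<close> are nonnegative integers with sum 1, so one of them
  is 1 and the others vanish.\<close>

lemma lattice_point_in_frame:
  assumes "W \<in> translates" "v \<in> int_lattice" "\<And>w. w \<in> W \<Longrightarrow> bary W w v \<ge> 0"
  shows "v \<in> W"
proof -
  note W = frame_translates[OF assms(1)]
  obtain w where w: "w \<in> W" "\<And>x. x \<in> W \<Longrightarrow> bary W x v = of_bool (x = w)"
    using nonneg_integers_sum_1[of W "\<lambda>w. bary W w v"] frame_finite[OF W] sum_bary[OF W]
      unimodular_translates assms by metis
  have "v = (\<Sum>x\<in>W. bary W x v *\<^sub>R x)" by (simp add: sum_bary_scaleR[OF W])
  also have "\<dots> = (\<Sum>x\<in>W. if x = w then x else 0)" by (intro sum.cong) (auto simp: w)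
  also have "\<dots> = w" using w(1) frame_finite[OF W] by simp
  finally show ?thesis using w(1) by simp
qed

lemma locally_Delone_translates:
  assumes Q: "transpose Q = Q" "locally_Delone Q" and W: "W \<in> translates" "w \<in> W"
  obtains u where "insert u (W - {w}) \<in> translates" "bary W w u < 0" "sphere_power Q W u > 0"
proof -
  obtain t V where V: "t \<in> int_lattice" "V \<in> R" "W = (+) t ` V" 
    using W(1) unfolding translates_def by blast
  then obtain w' where w': "w' \<in> V" "w = t + w'" using W(2) by blast
  obtain u where u: "insert u (V - {w'}) \<in> translates" "bary V w' u < 0" "sphere_power Q V u > 0"
    using Q(2) V(2) w'(1) unfolding locally_Delone_def by blast
  have "insert (t + u) (W - {w}) = (+) t ` insert u (V - {w'})" using V w' by auto
  then have "insert (t + u) (W - {w}) \<in> translates" using translates_translate[OF u(1) V(1)] by simp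
  moreover have "bary W w (t + u) < 0" 
    using u frame_translate(2)[OF frame_R[OF V(2)] w'(1), of t u] V w' by simp
  moreover have "sphere_power Q W (t + u) > 0" 
    using u sphere_power_translate[OF Q(1) frame_R[OF V(2)], of t u] V by simp
  ultimately show ?thesis using that by blast
qed

text \<open>As a function of the translation vector, the power at \<open>x\<close> is a shifted
  positive definite form minus a constant, so only finitely many translates stay below a given
  value.\<close>

lemma sphere_power_minimizer:
  assumes Q: "pqf Q"
  obtains W where "W \<in> translates" "\<And>V. V \<in> translates \<Longrightarrow> sphere_power Q W x \<le> sphere_power Q V x"
proof -
  obtain W1 where W1: "W1 \<in> translates" using R_nonempty R_translates by blast
  define K where "K = sphere_power Q W1 x"
  define S where "S = (\<lambda>V. {t \<in> int_lattice. sphere_power Q ((+) t ` V) x \<le> K})"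
  have "finite (S V)" if V: "V \<in> R" for V
  proof -
    obtain c s where cs: "\<And>x. sphere_power Q V x = quad_form Q (x - c) - s"
      using sphere_power_center[OF Q frame_R[OF V]] by metis
    have "sphere_power Q ((+) t ` V) x = quad_form Q (t - (x - c)) - s" for t
    proof -
      have "sphere_power Q ((+) t ` V) (t + (x - t)) = quad_form Q (x - t - c) - s"
        by (simp only: sphere_power_translate[OF pqf_sym[OF Q] frame_R[OF V]] cs)
      also have "x - t - c = - (t - (x - c))" by simp
      finally show ?thesis by (simp only: quad_form_minus) simp
    qed
    then have "S V = {t \<in> int_lattice. quad_form Q (t - (x - c)) \<le> K + s}" by (auto simp: S_def)
    then show ?thesis using finite_pqf_sublevel[OF Q] by simp
  qed
  then have fin: "finite (\<Union>V\<in>R. (\<lambda>t. (+) t ` V) ` S V)" using finite_R by blast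
  have eq: "{W \<in> translates. sphere_power Q W x \<le> K} \<subseteq> (\<Union>V\<in>R. (\<lambda>t. (+) t ` V) ` S V)"
    by (auto simp: translates_def S_def)
  then have fin': "finite {W \<in> translates. sphere_power Q W x \<le> K}" by (rule finite_subset[OF _ fin])
  have W1': "W1 \<in> {W \<in> translates. sphere_power Q W x \<le> K}" using W1 K_def by simp
  define W where "W = arg_min_on (\<lambda>W. sphere_power Q W x) {W \<in> translates. sphere_power Q W x \<le> K}"
  have W: "W \<in> {W \<in> translates. sphere_power Q W x \<le> K}"
    unfolding W_def by (rule arg_min_if_finite(1)[OF fin']) (use W1' in blast)
  have min: "sphere_power Q W x \<le> sphere_power Q V x" if "V \<in> translates" "sphere_power Q V x \<le> K" for V
    unfolding W_def by (rule arg_min_least[OF fin']) (use W1' that in auto)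
  have "sphere_power Q W x \<le> sphere_power Q V x" if "V \<in> translates" for V
    using min[OF that] W by fastforce
  then show ?thesis using that W by blast
qed

lemma minimizer_covers:
  assumes Q: "pqf Q" "locally_Delone Q" and W: "W \<in> translates"
    and min: "\<And>V. V \<in> translates \<Longrightarrow> sphere_power Q W x \<le> sphere_power Q V x" and w: "w \<in> W"
  shows "bary W w x \<ge> 0"
proof (rule ccontr)
  assume "\<not> bary W w x \<ge> 0"
  moreover obtain u where u: "insert u (W - {w}) \<in> translates" "bary W w u < 0" "sphere_power Q W u > 0"
    using locally_Delone_translates[OF pqf_sym[OF Q(1)] Q(2) W w] by metis
  ultimately have "sphere_power Q (insert u (W - {w})) x < sphere_power Q W x"
    by (intro sphere_power_flip frame_translates W w) auto
  then show False using min[OF u(1)] by simp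
qed

lemma covering:
  assumes Q: "pqf Q" "locally_Delone Q"
  obtains W where "W \<in> translates" "\<And>w. w \<in> W \<Longrightarrow> bary W w x \<ge> 0"
  using sphere_power_minimizer[OF Q(1)] minimizer_covers[OF Q] by metis

text \<open>The simplex minimizing the power of \<open>v\<close> has \<open>v\<close> as a vertex,
  so the minimum is 0. For strictness, some facet separates \<open>v\<close> from \<open>W\<close>;
  crossing it lowers the power strictly, and the result is still at least 0.\<close>

lemma globally_Delone:
  assumes Q: "pqf Q" "locally_Delone Q" and W: "W \<in> translates" and v: "v \<in> int_lattice" "v \<notin> W"
  shows "sphere_power Q W v > 0"
proof -
  obtain M where M: "M \<in> translates" "\<And>V. V \<in> translates \<Longrightarrow> sphere_power Q M v \<le> sphere_power Q V v"
    using sphere_power_minimizer[OF Q(1)] by metis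
  have "v \<in> M" 
    by (rule lattice_point_in_frame[OF M(1) v(1)]) (rule minimizer_covers[OF Q M])
  then have M0: "sphere_power Q M v = 0" by (simp add: sphere_power_vertex frame_translates[OF M(1)])
  obtain w where w: "w \<in> W" "bary W w v < 0"
    using lattice_point_in_frame[OF W v(1)] v(2) by (meson not_le_imp_less)
  obtain u where u: "insert u (W - {w}) \<in> translates" "bary W w u < 0" "sphere_power Q W u > 0"
    using locally_Delone_translates[OF pqf_sym[OF Q(1)] Q(2) W w(1)] by metis
  then have "sphere_power Q (insert u (W - {w})) v < sphere_power Q W v"
    by (intro sphere_power_flip frame_translates W w) auto
  then show ?thesis using M(2)[OF u(1)] M0 by simp
qed

text \<open>Let \<open>W\<close> contain the barycentre \<open>x\<close> of \<open>V\<close>. The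
  affine function \<open>h\<close> is nonnegative on the vertices of \<open>W\<close>, hence at
  \<open>x\<close>; but \<open>h x\<close> is also minus the mean over \<open>V\<close> of the power
  with respect to \<open>W\<close>. So this power vanishes on \<open>V\<close>, which forces
  \<open>V\<close> into \<open>W\<close>.\<close>

lemma Delone_subset_faces:
  assumes Q: "pqf Q" "locally_Delone Q"
  shows "Delone Q \<subseteq> faces"
proof
  fix P assume "P \<in> Delone Q"
  then obtain V c r where V: "P = convex hull V" "V \<noteq> {}" "finite V" "V \<subseteq> int_lattice"
      "\<forall>v\<in>V. quad_form Q (v - c) = r\<^sup>2" "\<forall>v\<in>int_lattice - V. quad_form Q (v - c) > r\<^sup>2"
    unfolding Delone_def by auto
  define f where "f = (\<lambda>x. quad_form Q (x - c) - r\<^sup>2)"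
  define x where "x = (\<Sum>v\<in>V. (1 / card V) *\<^sub>R v)"
  obtain W where W: "W \<in> translates" "\<And>w. w \<in> W \<Longrightarrow> bary W w x \<ge> 0"
    using covering[OF Q] by metis
  note Wf = frame_translates[OF W(1)]
  define h where "h = (\<lambda>y. f y - sphere_power Q W y)"
  have "affine_fun (\<lambda>y. (quad_form Q (y + - c) - quad_form Q y) + (quad_form Q y - sphere_power Q W y) + - r\<^sup>2)"
    by (intro affine_fun_add affine_fun_quad_form_translate affine_fun_sphere_power affine_fun_const
         pqf_sym Q Wf)
  then have aff: "affine_fun h" by (simp add: h_def f_def algebra_simps)
  have f0: "f v \<ge> 0" if "v \<in> int_lattice" for v
    using V(5,6) that by (cases "v \<in> V") (auto simp: f_def less_imp_le)
  have p0: "sphere_power Q W v \<ge> 0" if "v \<in> int_lattice" for v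
    using globally_Delone[OF Q W(1) that] sphere_power_vertex[OF Wf] by fastforce
  have "h x = (\<Sum>w\<in>W. bary W w x * h w)" by (rule frame_interpolate[OF frameD[OF Wf] aff])
  also have "\<dots> \<ge> 0"
    using f0 lattice_translates[OF W(1)] 
    by (intro sum_nonneg mult_nonneg_nonneg W) (auto simp: h_def sphere_power_vertex[OF Wf])
  finally have hx: "h x \<ge> 0" .
  obtain l k where lk: "linear l" "h = (\<lambda>x. l x + k)" using aff unfolding affine_fun_def by blast
  have c0: "card V > 0" using V by (simp add: card_gt_0_iff)
  have "h x = (\<Sum>v\<in>V. (1 / card V) * l v) + k"
    unfolding x_def lk by (simp add: linear_sum[OF lk(1)] linear_scale[OF lk(1)])
  also have "k = (\<Sum>v\<in>V. (1 / card V) * k)" using c0 by simp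
  finally have "h x = (\<Sum>v\<in>V. (1 / card V) * h v)"
    by (simp only: lk sum.distrib distrib_left)
  also have "\<dots> = - (\<Sum>v\<in>V. (1 / card V) * sphere_power Q W v)"
    using V(5) by (simp add: h_def f_def sum_negf)
  finally have "(\<Sum>v\<in>V. (1 / card V) * sphere_power Q W v) \<le> 0" using hx by simp
  moreover have "(\<Sum>v\<in>V. (1 / card V) * sphere_power Q W v) \<ge> 0"
    using V(4) p0 by (intro sum_nonneg) auto
  ultimately have "(\<Sum>v\<in>V. (1 / card V) * sphere_power Q W v) = 0" by simp
  then have "\<forall>v\<in>V. (1 / card V) * sphere_power Q W v = 0"
    using V(3,4) p0 by (subst (asm) sum_nonneg_eq_0_iff) auto
  then have "\<forall>v\<in>V. sphere_power Q W v = 0" using c0 by simp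
  then have "V \<subseteq> W" using globally_Delone[OF Q W(1)] V(4) by (metis less_irrefl subset_eq)
  then show "P \<in> faces" using V W(1) unfolding faces_def by blast
qed

text \<open>
  For a face \<open>V\<close> of \<open>W\<close>, adding a small multiple of the affine function that is 0 on \<open>V\<close> and 1 on
  \<open>W - V\<close> to the power function of \<open>W\<close> gives a sphere through \<open>V\<close> only: just the finitely many
  lattice points in \<open>B\<close> restrict the multiple.
\<close>

lemma faces_subset_Delone:
  assumes Q: "pqf Q" "locally_Delone Q"
  shows "faces \<subseteq> Delone Q"
proof
  fix P assume "P \<in> faces"
  then obtain V W where V: "P = convex hull V" "V \<noteq> {}" "V \<subseteq> W" and W: "W \<in> translates"
    unfolding faces_def by auto
  note Wf = frame_translates[OF W]
  have finW: "finite W" and finV: "finite V" 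
    using frame_finite[OF Wf] V(3) finite_subset by auto
  define l where "l = (\<lambda>x. \<Sum>w\<in>W - V. bary W w x)"
  have aff: "affine_fun l" unfolding l_def by (intro affine_fun_sum affine_fun_bary Wf) auto
  have l: "l w = of_bool (w \<notin> V)" if "w \<in> W" for w
  proof -
    have "l w = (\<Sum>v\<in>W - V. if v = w then 1 else 0)"
      unfolding l_def by (intro sum.cong) (auto simp: bary_vertex[OF Wf _ that])
    then show ?thesis using finW that by simp
  qed
  have aff2: "affine_fun (\<lambda>x. quad_form Q x - (sphere_power Q W x + e * l x))" for e
    using affine_fun_diff[OF affine_fun_sphere_power[OF Wf, of Q] affine_fun_cmult[OF aff, of e]]
    by (simp add: algebra_simps)
  define B where "B = {v \<in> int_lattice. sphere_power Q W v + 1 * l v \<le> 0}"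
  obtain c s where cs: "\<And>x. sphere_power Q W x + 1 * l x = quad_form Q (x - c) - s"
    using pqf_complete_square[OF Q(1) aff2[of 1]] by (metis diff_diff_eq2 add_diff_cancel_left')
  have "finite B" unfolding B_def cs using finite_pqf_sublevel[OF Q(1), of c s] by simp
  have BW: "sphere_power Q W v > 0" if "v \<in> B" "v \<notin> W" for v
    using globally_Delone[OF Q W _ that(2)] that(1) by (simp add: B_def)
  \<comment> \<open>The denominator makes \<open>e * \<bar>l v\<bar>\<close> strictly smaller than
    the power at \<open>v\<close>. The inserted 1 keeps the set nonempty and gives
    \<open>e \<le> 1\<close>.\<close>
  define e where "e = Min (insert 1 ((\<lambda>v. sphere_power Q W v / (1 + \<bar>l v\<bar>)) ` (B - W)))"
  have fin: "finite (insert 1 ((\<lambda>v. sphere_power Q W v / (1 + \<bar>l v\<bar>)) ` (B - W)))"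
    using \<open>finite B\<close> by simp
  have e: "e > 0" "e \<le> 1" "\<And>v. v \<in> B - W \<Longrightarrow> e \<le> sphere_power Q W v / (1 + \<bar>l v\<bar>)"
  proof -
    show "e > 0" unfolding e_def using fin BW by (subst Min_gr_iff) (auto intro!: divide_pos_pos)
    show "e \<le> 1" unfolding e_def using fin by (intro Min_le) auto
    show "e \<le> sphere_power Q W v / (1 + \<bar>l v\<bar>)" if "v \<in> B - W" for v 
      unfolding e_def using fin that by (intro Min_le) auto
  qed
  obtain c' s' where cs': "\<And>x. sphere_power Q W x + e * l x = quad_form Q (x - c') - s'"
    using pqf_complete_square[OF Q(1) aff2[of e]] by (metis diff_diff_eq2 add_diff_cancel_left')
  have V0: "quad_form Q (v - c') = s'" if "v \<in> V" for v
    using cs'[of v] V(3) that l[of v] sphere_power_vertex[OF Wf, of v Q] by auto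
  have pos: "quad_form Q (v - c') > s'" if v: "v \<in> int_lattice - V" for v
  proof -
    have "sphere_power Q W v + e * l v > 0"
    proof (cases "v \<in> W")
      case True then show ?thesis using v e l[of v] sphere_power_vertex[OF Wf, of v Q] by auto
    next
      case False
      then have p: "sphere_power Q W v > 0" using globally_Delone[OF Q W] v by auto
      show ?thesis
      proof (cases "v \<in> B")
        case True
        then have "e * (1 + \<bar>l v\<bar>) \<le> sphere_power Q W v" using e(3)[of v] False 
          by (simp add: pos_le_divide_eq add_pos_nonneg)
        moreover have "e * (1 + \<bar>l v\<bar>) > - (e * l v)" using e(1) 
          by (smt (verit, best) mult_less_cancel_left_pos mult_minus_right)
        ultimately show ?thesis by linarith
      next
        case False
        \<comment> \<open>The power plus \<open>e * l\<close> is the convex combination, with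
          weights \<open>e\<close> and \<open>1 - e\<close>, of the power plus \<open>l\<close> and
          the power itself.\<close>
        then have "sphere_power Q W v + l v > 0" using v by (auto simp: B_def)
        then have "e * (sphere_power Q W v + l v) > 0" using e(1) by simp
        moreover have "(1 - e) * sphere_power Q W v \<ge> 0" using e(2) p by simp
        ultimately show ?thesis by (simp add: algebra_simps)
      qed
    qed
    then show ?thesis using cs'[of v] by simp
  qed
  \<comment> \<open>\<open>Delone\<close> asks for a squared radius; the value at any point of
    \<open>V\<close> shows that \<open>s'\<close> is one.\<close>
  have "s' \<ge> 0" using V(2) V0 pqf_nonneg[OF Q(1)] by (metis ex_in_conv)
  then have "s' = (sqrt s')\<^sup>2" by simp
  then have "\<exists>c r. (\<forall>v\<in>V. quad_form Q (v - c) = r\<^sup>2) \<and> (\<forall>v\<in>int_lattice - V. quad_form Q (v - c) > r\<^sup>2)"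
    using V0 pos by metis
  moreover have "V \<subseteq> int_lattice" using V(3) lattice_translates[OF W] by blast
  ultimately show "P \<in> Delone Q" unfolding Delone_def using V finV by blast
qed

lemma Delone_eq_faces: "pqf Q \<Longrightarrow> locally_Delone Q \<Longrightarrow> Delone Q = faces"
  using Delone_subset_faces faces_subset_Delone by blast

lemma faces_simplex:
  assumes "P \<in> faces" shows "\<exists>k. k simplex P"
proof -
  obtain V W where V: "P = convex hull V" "V \<noteq> {}" "V \<subseteq> W" and W: "W \<in> translates"
    using assms unfolding faces_def by auto
  note Wf = frame_translates[OF W]
  have "\<not> affine_dependent V" using V(3) frame_affine_independent[OF Wf] affine_dependent_subset by blast
  then have "(int (card V) - 1) simplex P" unfolding simplex_def using V by (intro exI[of _ V]) auto
  then show ?thesis by blast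
qed

end

section \<open>The inhomogeneous minimum and perturbation of the form\<close>

lemma quad_form_sum: "quad_form Q x = (\<Sum>i\<in>UNIV. \<Sum>j\<in>UNIV. Q $ i $ j * (x $ i * x $ j))"
  by (simp add: quad_form_def inner_vec_def matrix_vector_mult_def sum_distrib_left mult_ac)

lemma quad_form_bound:
  "\<bar>quad_form Q x\<bar> \<le> (\<Sum>i\<in>UNIV. \<Sum>j\<in>UNIV. \<bar>Q $ i $ j\<bar>) * (norm x)\<^sup>2"
proof -
  have "\<bar>quad_form Q x\<bar> \<le> (\<Sum>i\<in>UNIV. \<Sum>j\<in>UNIV. \<bar>Q $ i $ j * (x $ i * x $ j)\<bar>)"
    unfolding quad_form_sum by (intro order_trans[OF sum_abs] sum_mono sum_abs)
  also have "\<dots> \<le> (\<Sum>i\<in>UNIV. \<Sum>j\<in>UNIV. \<bar>Q $ i $ j\<bar> * (norm x)\<^sup>2)"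
    unfolding abs_mult power2_eq_square
    by (intro sum_mono mult_left_mono mult_mono component_le_norm_cart) auto
  finally show ?thesis by (simp add: sum_distrib_right)
qed

lemma quad_form_diff_matrix: "quad_form (Q - Q') x = quad_form Q x - quad_form Q' x"
  by (simp add: quad_form_sum algebra_simps sum_subtractf)

lemma tendsto_quad_form: "((\<lambda>Q. quad_form Q x) \<longlongrightarrow> quad_form Q x) (nhds Q)"
  unfolding quad_form_sum by (intro tendsto_intros) (simp add: filterlim_ident)

lemma tendsto_sphere_power: "((\<lambda>Q. sphere_power Q W x) \<longlongrightarrow> sphere_power Q W x) (nhds Q)"
  unfolding sphere_power_def by (intro tendsto_intros tendsto_quad_form)

text \<open>The coercivity constant of \<open>Q\<close> exceeds the entrywise distance to any
  sufficiently close matrix.\<close>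

lemma eventually_pqf:
  assumes Q: "pqf Q"
  shows "\<forall>\<^sub>F Q' in nhds Q. transpose Q' = Q' \<longrightarrow> pqf Q'"
proof -
  obtain m where m: "m > 0" "\<And>x. quad_form Q x \<ge> m * (norm x)\<^sup>2" using pqf_coercive[OF Q] by metis
  let ?d = "\<lambda>Q'. \<Sum>i\<in>UNIV. \<Sum>j\<in>UNIV. \<bar>(Q - Q') $ i $ j\<bar>"
  have "(?d \<longlongrightarrow> (\<Sum>i\<in>UNIV. \<Sum>j\<in>UNIV. \<bar>(Q - Q) $ i $ j\<bar>)) (nhds Q)"
    by (intro tendsto_intros) (simp add: filterlim_ident)
  then have "\<forall>\<^sub>F Q' in nhds Q. ?d Q' < m" using m(1) by (intro order_tendstoD) auto
  then show ?thesis
  proof eventually_elim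
    case (elim Q')
    show ?case
    proof
      assume sym: "transpose Q' = Q'"
      have "quad_form Q' x > 0" if "x \<noteq> 0" for x
      proof -
        have "quad_form Q x - quad_form Q' x \<le> ?d Q' * (norm x)\<^sup>2"
          using quad_form_bound[of "Q - Q'" x] by (simp add: quad_form_diff_matrix)
        also have "\<dots> < m * (norm x)\<^sup>2" using elim that by (intro mult_strict_right_mono) auto
        finally show ?thesis using m(2)[of x] by linarith
      qed
      then show "pqf Q'" using sym by (simp add: pqf_def)
    qed
  qed
qed

lemma bdd_below_quad_form: "pqf Q \<Longrightarrow> bdd_below ((\<lambda>v. quad_form Q (x - v)) ` S)"
  by (rule bdd_belowI[of _ 0]) (auto simp: pqf_nonneg)

text \<open>Rounding down the coordinates gives a lattice point at bounded distance. This makes the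
  supremum in \<open>inhom_min\<close> meaningful.\<close>

lemma bdd_above_INF_quad_form:
  fixes Q :: "real^'n^'n"
  assumes Q: "pqf Q"
  shows "bdd_above (range (\<lambda>x. INF v\<in>int_lattice. quad_form Q (x - v)))"
proof (rule bdd_aboveI)
  let ?K = "\<Sum>i\<in>UNIV. \<Sum>j\<in>UNIV. \<bar>Q $ i $ j\<bar>"
  fix y assume "y \<in> range (\<lambda>x. INF v\<in>int_lattice. quad_form Q (x - v))"
  then obtain x where y: "y = (INF v\<in>int_lattice. quad_form Q (x - v))" by auto
  define v :: "real^'n" where "v = (\<chi> i. of_int \<lfloor>x $ i\<rfloor>)"
  have "v \<in> int_lattice" by (simp add: v_def int_lattice_def)
  then have "y \<le> quad_form Q (x - v)" 
    unfolding y by (intro cINF_lower bdd_below_quad_form Q)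
  also have "\<dots> \<le> ?K * (norm (x - v))\<^sup>2" using quad_form_bound[of Q "x - v"] by simp
  also have "\<dots> \<le> ?K * (real CARD('n))\<^sup>2"
  proof (intro mult_left_mono power_mono sum_nonneg)
    have "norm (x - v) \<le> (\<Sum>i\<in>UNIV. \<bar>(x - v) $ i\<bar>)" by (rule norm_le_l1_cart)
    also have "\<dots> \<le> (\<Sum>i\<in>(UNIV::'n set). 1)"
    proof (rule sum_mono)
      fix i show "\<bar>(x - v) $ i\<bar> \<le> 1" unfolding v_def 
        by (simp add: abs_if) linarith
    qed
    finally show "norm (x - v) \<le> real CARD('n)" by simp
  qed auto
  finally show "y \<le> ?K * (real CARD('n))\<^sup>2" .
qed

text \<open>Expand \<open>Q[w - x]\<close>; the coordinates sum to 1 and reproduce \<open>x\<close>.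
  At the circumcentre both sides are the squared circumradius.\<close>

lemma sum_bary_quad_form:
  assumes Q: "transpose Q = Q" and W: "frame W"
  shows "(\<Sum>w\<in>W. bary W w x * quad_form Q (w - x)) = - sphere_power Q W x"
proof -
  have e: "quad_form Q (w - x) = quad_form Q x - 2 * (x \<bullet> (Q *v w)) + quad_form Q w" for w
    using quad_form_add[OF Q, of "-x" w] by (simp add: quad_form_minus)
  have "(\<Sum>w\<in>W. bary W w x * quad_form Q (w - x)) = 
     quad_form Q x * (\<Sum>w\<in>W. bary W w x) - 2 * (x \<bullet> (Q *v (\<Sum>w\<in>W. bary W w x *\<^sub>R w)))
       + (\<Sum>w\<in>W. bary W w x * quad_form Q w)"
    by (simp add: e linear_sum[OF matrix_vector_mul_linear] matrix_vector_mult_scaleR inner_sum_right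
        algebra_simps sum.distrib sum_subtractf sum_distrib_left)
  also have "\<dots> = - sphere_power Q W x"
    by (simp add: sum_bary[OF W] sum_bary_scaleR[OF W] sphere_power_def quad_form_def)
  finally show ?thesis .
qed

context unimodular_frames
begin

text \<open>The same neighbours \<open>u\<close> serve for nearby forms: the power at
  \<open>u\<close> depends continuously on the form.\<close>

lemma eventually_locally_Delone:
  assumes "locally_Delone Q"
  shows "\<forall>\<^sub>F Q' in nhds Q. locally_Delone Q'"
proof -
  have "\<forall>\<^sub>F Q' in nhds Q. \<forall>W\<in>R. \<forall>w\<in>W. \<exists>u\<in>int_lattice.
     insert u (W - {w}) \<in> translates \<and> bary W w u < 0 \<and> sphere_power Q' W u > 0"
  proof (intro eventually_ball_finite ballI finite_R)
    fix W assume W: "W \<in> R" 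
    show "finite W" using frame_R[OF W] by (rule frame_finite)
    fix w assume w: "w \<in> W"
    obtain u where u: "u\<in>int_lattice"
     "insert u (W - {w}) \<in> translates" "bary W w u < 0" "sphere_power Q W u > 0"
      using assms W w unfolding locally_Delone_def by blast
    have "\<forall>\<^sub>F Q' in nhds Q. sphere_power Q' W u > 0"
      by (rule order_tendstoD(1)[OF tendsto_sphere_power u(4)])
    then show "\<forall>\<^sub>F Q' in nhds Q. \<exists>u\<in>int_lattice.
     insert u (W - {w}) \<in> translates \<and> bary W w u < 0 \<and> sphere_power Q' W u > 0"
      by eventually_elim (use u in blast)
  qed
  then show ?thesis by (simp add: locally_Delone_def)
qed

text \<open>The left side is at most the squared circumradius \<open>s\<close> of \<open>W\<close>,
  and no lattice point is closer to the circumcentre than the vertices of \<open>W\<close>.\<close>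

lemma sphere_power_le_inhom_min:
  assumes Q: "pqf Q" "locally_Delone Q" and W: "W \<in> translates"
  shows "- sphere_power Q W x \<le> inhom_min Q"
proof -
  obtain c s where cs: "\<And>x. sphere_power Q W x = quad_form Q (x - c) - s"
    using sphere_power_center[OF Q(1) frame_translates[OF W]] by metis
  have "- sphere_power Q W x \<le> s" using pqf_nonneg[OF Q(1), of "x - c"] by (simp add: cs)
  also have "s \<le> (INF v\<in>int_lattice. quad_form Q (c - v))"
  proof (rule cINF_greatest)
    show "int_lattice \<noteq> {}" using int_lattice_0 by blast
    fix v :: "real^'n" assume v: "v \<in> int_lattice"
    have "sphere_power Q W v \<ge> 0"
      using globally_Delone[OF Q W v] sphere_power_vertex[OF frame_translates[OF W], of v Q] by fastforce
    then show "s \<le> quad_form Q (c - v)" using quad_form_minus[of Q "c - v"] by (simp add: cs)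
  qed
  also have "\<dots> \<le> inhom_min Q"
    unfolding inhom_min_def by (intro cSUP_upper bdd_above_INF_quad_form Q) auto
  finally show ?thesis .
qed

text \<open>The point \<open>x\<close> lies in some translate \<open>W\<close>. A mean of the
  squared distances to its vertices is at most \<open>\<mu>\<close>, so one of these distances
  is.\<close>

lemma inhom_min_le:
  assumes Q: "pqf Q" "locally_Delone Q" and mu: "\<And>W x. W \<in> R \<Longrightarrow> - sphere_power Q W x \<le> \<mu>"
  shows "inhom_min Q \<le> \<mu>"
  unfolding inhom_min_def
proof (rule cSUP_least)
  fix x
  obtain W where W: "W \<in> translates" "\<And>w. w \<in> W \<Longrightarrow> bary W w x \<ge> 0"
    using covering[OF Q] by metis
  note Wf = frame_translates[OF W(1)]
  obtain t V where V: "V \<in> R" "W = (+) t ` V" using W(1) unfolding translates_def by blast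
  have "sphere_power Q W x = sphere_power Q V (x - t)"
    using sphere_power_translate[OF pqf_sym[OF Q(1)] frame_R[OF V(1)], of t "x - t"] V(2) by simp
  then have "(\<Sum>w\<in>W. bary W w x * quad_form Q (w - x)) = - sphere_power Q V (x - t)"
    by (simp add: sum_bary_quad_form[OF pqf_sym[OF Q(1)] Wf])
  also have "\<dots> \<le> \<mu>" using mu V(1) by blast
  finally have le: "(\<Sum>w\<in>W. bary W w x * quad_form Q (w - x)) \<le> \<mu>" .
  have "\<exists>w\<in>W. quad_form Q (x - w) \<le> \<mu>"
  proof (rule ccontr)
    assume "\<not> ?thesis"
    then have gt: "quad_form Q (w - x) > \<mu>" if "w \<in> W" for w 
      using that quad_form_minus[of Q "x - w"] by fastforce
    obtain w where w: "w \<in> W" "bary W w x \<noteq> 0" using sum_bary[OF Wf] by (metis sum.neutral zero_neq_one)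
    have "\<mu> = (\<Sum>w\<in>W. bary W w x * \<mu>)" by (simp add: sum_bary[OF Wf] flip: sum_distrib_right)
    also have "\<dots> < (\<Sum>w\<in>W. bary W w x * quad_form Q (w - x))"
    proof (rule sum_strict_mono_ex1)
      show "\<forall>w\<in>W. bary W w x * \<mu> \<le> bary W w x * quad_form Q (w - x)"
        using W(2) gt by (auto intro!: mult_left_mono simp: less_imp_le)
      have "bary W w x > 0" using w W(2) by (metis order_le_less)
      then show "\<exists>w\<in>W. bary W w x * \<mu> < bary W w x * quad_form Q (w - x)"
        using w(1) gt by (intro bexI[of _ w]) auto
    qed (rule frame_finite[OF Wf])
    finally show False using le by simp
  qed
  then obtain w where w: "w \<in> W" "quad_form Q (x - w) \<le> \<mu>" by blast
  have "(INF v\<in>int_lattice. quad_form Q (x - v)) \<le> quad_form Q (x - w)"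
    using w(1) lattice_translates[OF W(1)] by (intro cINF_lower bdd_below_quad_form Q) auto
  then show "(INF v\<in>int_lattice. quad_form Q (x - v)) \<le> \<mu>" using w(2) by simp
qed simp

text \<open>Nearby symmetric forms are positive definite and locally Delone, and then their Delone
  polytopes are \<open>faces\<close>, which does not depend on the form.\<close>

lemma in_interior_of_secondary_cone:
  assumes Q: "pqf Q" "locally_Delone Q"
  shows "in_interior_of_secondary_cone Q"
proof -
  have "\<forall>\<^sub>F Q' in nhds Q. transpose Q' = Q' \<longrightarrow> Q' \<in> secondary_cone (Delone Q)"
    using eventually_pqf[OF Q(1)] eventually_locally_Delone[OF Q(2)]
    by eventually_elim (use Delone_eq_faces Q in \<open>auto simp: secondary_cone_def\<close>)
  then obtain U where U: "open U" "Q \<in> U" 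
      "\<And>Q'. Q' \<in> U \<Longrightarrow> transpose Q' = Q' \<Longrightarrow> Q' \<in> secondary_cone (Delone Q)"
    unfolding eventually_nhds by blast
  let ?S = "{S::real^'n^'n. transpose S = S}"
  have "openin (top_of_set ?S) (?S \<inter> U)" using U(1) by blast
  then have "Q \<in> (top_of_set ?S) interior_of (secondary_cone (Delone Q))"
    unfolding interior_of_def using U(2,3) pqf_sym[OF Q(1)] by blast
  then show ?thesis unfolding in_interior_of_secondary_cone_def Delone_triangulation_def
    using faces_simplex Delone_eq_faces[OF Q] by blast
qed

end

section \<open>Hadamard's inequality\<close>

lemma quad_form_axis: "quad_form Q (axis k 1) = Q $ k $ k"
  unfolding quad_form_sum axis_def
  by (simp add: if_distrib[of "\<lambda>x. _ * x"] if_distrib[of "\<lambda>x. x * _"] cong: if_cong)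

lemma pqf_diagonal_pos: "pqf Q \<Longrightarrow> Q $ k $ k > 0"
  unfolding pqf_def quad_form_axis[symmetric] by simp

lemma symmetric_entry: "transpose Q = Q \<Longrightarrow> Q $ i $ j = Q $ j $ i"
  by (metis transpose_def vec_lambda_beta)

text \<open>The determinant of this matrix is the principal minor without row and column
  \<open>k\<close>; padding by a unit vector keeps the index type.\<close>

definition split_off :: "'n \<Rightarrow> real^'n^'n \<Rightarrow> real^'n^'n" where
  "split_off k B = (\<chi> i j. if i = k \<or> j = k then of_bool (i = j) else B $ i $ j)"

lemma pqf_split_off:
  fixes B :: "real^'n^'n"
  assumes B: "pqf B" shows "pqf (split_off k B)"
  unfolding pqf_def
proof (intro conjI allI impI)
  show "transpose (split_off k B) = split_off k B"
    using symmetric_entry[OF pqf_sym[OF B]] by (simp add: vec_eq_iff transpose_def split_off_def)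
next
  fix x :: "real^'n" assume x: "x \<noteq> 0"
  define y :: "real^'n" where "y = (\<chi> i. if i = k then 0 else x $ i)"
  have "quad_form (split_off k B) x = (\<Sum>i\<in>UNIV. \<Sum>j\<in>UNIV. B $ i $ j * (y $ i * y $ j) 
      + (if j = k then if i = k then (x $ k)\<^sup>2 else 0 else 0))"
    unfolding quad_form_sum by (intro sum.cong refl) (auto simp: split_off_def y_def power2_eq_square)
  then have e: "quad_form (split_off k B) x = quad_form B y + (x $ k)\<^sup>2"
    by (simp add: sum.distrib quad_form_sum)
  show "quad_form (split_off k B) x > 0"
  proof (cases "y = 0")
    case True
    then have "x $ k \<noteq> 0" using x by (auto simp: vec_eq_iff y_def split: if_splits)
    then show ?thesis using True by (simp add: e)
  next
    case False
    then show ?thesis using B by (simp add: e pqf_def add_pos_nonneg)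
  qed
qed

text \<open>A permutation moving \<open>k\<close> picks a zero of column \<open>k\<close> on both
  sides, so row \<open>k\<close> matters only in its diagonal entry.\<close>

lemma det_split_off:
  fixes B :: "real^'n^'n"
  shows "det (\<chi> i j. if j = k then axis k 1 $ i else B $ i $ j) = det (split_off k B)"
  unfolding det_def
proof (intro sum.cong refl)
  fix p assume "p \<in> {p. p permutes (UNIV::'n set)}"
  then have p: "p permutes UNIV" by simp
  show "of_int (sign p) * (\<Prod>i\<in>UNIV. (\<chi> i j. if j = k then axis k 1 $ i else B $ i $ j) $ i $ p i) =
        of_int (sign p) * (\<Prod>i\<in>UNIV. split_off k B $ i $ p i)"
  proof (cases "p k = k")
    case True
    then have "p i \<noteq> k" if "i \<noteq> k" for i using permutes_inj[OF p] that by (metis injD)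
    then have "(\<chi> i j. if j = k then axis k 1 $ i else B $ i $ j) $ i $ p i = split_off k B $ i $ p i" for i
      using True by (cases "i = k") (auto simp: split_off_def axis_def)
    then show ?thesis by simp
  next
    case False
    obtain i where i: "p i = k" using permutes_surj[OF p] by (metis surjD)
    then have "i \<noteq> k" using False by auto
    then have "(\<Prod>i\<in>UNIV. (\<chi> i j. if j = k then axis k 1 $ i else B $ i $ j) $ i $ p i) = 0"
      using i by (intro prod_zero bexI[of _ i]) (auto simp: axis_def)
    moreover have "(\<Prod>i\<in>UNIV. split_off k B $ i $ p i) = 0"
      using i \<open>i \<noteq> k\<close> by (intro prod_zero bexI[of _ i]) (auto simp: split_off_def)
    ultimately show ?thesis by (simp only:)
  qed
qed

text \<open>
  If \<open>B x\<close> is the \<open>k\<close>-th unit vector, then \<open>x\<^sub>k = det (split_off k B) / det B\<close> by Cramer's rule,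
  and \<open>B\<^sub>k\<^sub>k x\<^sub>k \<ge> 1\<close> by the Cauchy-Schwarz inequality for the scalar product of \<open>B\<close>.
\<close>

lemma det_le_split_off:
  fixes B :: "real^'n^'n"
  assumes B: "pqf B" and pos: "det (split_off k B) > 0"
  shows "0 < det B" "det B \<le> B $ k $ k * det (split_off k B)"
proof -
  obtain x where x: "B *v x = axis k 1" using pqf_surj[OF B] by (metis surjD)
  have "x \<noteq> 0" using x by (auto simp: axis_eq_0_iff)
  then have "quad_form B x > 0" using B by (simp add: pqf_def)
  then have xk: "x $ k > 0" "quad_form B x = x $ k" by (simp_all add: quad_form_def x inner_axis)
  have d: "det (split_off k B) = x $ k * det B"
    using cramer_lemma[of k B x] unfolding x by (simp only: det_split_off)
  then show "0 < det B" using pos xk(1) by (simp add: zero_less_mult_iff)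
  have Bk: "B $ k $ k > 0" by (rule pqf_diagonal_pos[OF B])
  have "0 \<le> quad_form B (axis k 1 + (- B $ k $ k) *\<^sub>R x)" by (rule pqf_nonneg[OF B])
  also have "\<dots> = B $ k $ k - 2 * B $ k $ k + (B $ k $ k)\<^sup>2 * x $ k"
    by (simp only: quad_form_add[OF pqf_sym[OF B]] quad_form_scaleR xk(2) quad_form_axis
        matrix_vector_mult_scaleR x) (simp add: inner_axis)
  finally have "0 \<le> B $ k $ k * (B $ k $ k * x $ k - 1)" by (simp add: power2_eq_square algebra_simps)
  then have "1 \<le> B $ k $ k * x $ k" using Bk by (simp add: zero_le_mult_iff)
  then have "det B * 1 \<le> det B * (B $ k $ k * x $ k)" 
    using \<open>0 < det B\<close> by (intro mult_left_mono) auto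
  then show "det B \<le> B $ k $ k * det (split_off k B)" by (simp add: d mult_ac)
qed

text \<open>Indices are split off one at a time; outside \<open>S\<close> the matrix is already the
  identity.\<close>

lemma Hadamard_aux:
  fixes B :: "real^'n^'n"
  assumes "finite S" "pqf B" "\<And>i j. i \<notin> S \<or> j \<notin> S \<Longrightarrow> B $ i $ j = of_bool (i = j)"
  shows "0 < det B \<and> det B \<le> (\<Prod>i\<in>S. B $ i $ i)"
  using assms
proof (induction S arbitrary: B rule: finite_induct)
  case empty
  then have "B = mat 1" by (simp add: vec_eq_iff mat_def)
  then show ?case by simp
next
  case (insert k S)
  have *: "0 < det (split_off k B) \<and> det (split_off k B) \<le> (\<Prod>i\<in>S. split_off k B $ i $ i)"
    by (rule insert.IH[OF pqf_split_off[OF insert.prems(1)]]) 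
       (use insert.prems(2) in \<open>auto simp: split_off_def\<close>)
  have "(\<Prod>i\<in>S. split_off k B $ i $ i) = (\<Prod>i\<in>S. B $ i $ i)"
    using insert.hyps(2) by (intro prod.cong refl) (auto simp: split_off_def)
  then have "B $ k $ k * det (split_off k B) \<le> B $ k $ k * (\<Prod>i\<in>S. B $ i $ i)"
    using * pqf_diagonal_pos[OF insert.prems(1), of k] by (intro mult_left_mono) auto
  then show ?case
    using det_le_split_off[OF insert.prems(1), of k] * insert.hyps by auto
qed

lemma
  fixes B :: "real^'n^'n"
  assumes "pqf B"
  shows pqf_det_pos: "0 < det B"
    and Hadamard: "det B \<le> (\<Prod>i\<in>UNIV. B $ i $ i)"
  using Hadamard_aux[of UNIV B] assms by auto

section \<open>Congruence, and the determinant against the trace\<close>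

lemma quad_form_congruence: "quad_form (transpose U ** Q ** U) x = quad_form Q (U *v x)"
  unfolding quad_form_def
  by (metis dot_lmul_matrix inner_commute matrix_vector_mul_assoc transpose_matrix_vector)

lemma pqf_congruence:
  fixes Q U :: "real^'n^'n"
  assumes Q: "pqf Q" and U: "det U \<noteq> 0" shows "pqf (transpose U ** Q ** U)"
  unfolding pqf_def
proof (intro conjI allI impI)
  show "transpose (transpose U ** Q ** U) = transpose U ** Q ** U"
    by (simp add: matrix_transpose_mul pqf_sym[OF Q] matrix_mul_assoc)
  fix x :: "real^'n" assume "x \<noteq> 0"
  moreover have "invertible U" using U by (simp add: invertible_det_nz)
  ultimately have "U *v x \<noteq> 0" using invertible_left_inverse matrix_left_invertible_ker by blast
  then show "quad_form (transpose U ** Q ** U) x > 0"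
    using Q by (simp add: quad_form_congruence pqf_def)
qed

text \<open>With \<open>m\<close> the mean, multiply the inequalities
  \<open>f i / m \<le> exp (f i / m - 1)\<close>; the exponents sum to 0.\<close>

lemma prod_le_mean_power:
  fixes f :: "'a \<Rightarrow> real"
  assumes "finite I" "I \<noteq> {}" "\<And>i. i \<in> I \<Longrightarrow> f i \<ge> 0"
  shows "(\<Prod>i\<in>I. f i) \<le> ((\<Sum>i\<in>I. f i) / card I) ^ card I"
proof (cases "\<exists>i\<in>I. f i = 0")
  case True
  then have "(\<Prod>i\<in>I. f i) = 0" using assms(1) by (simp add: prod_zero)
  moreover have "0 \<le> ((\<Sum>i\<in>I. f i) / card I) ^ card I" using assms(3) by (simp add: sum_nonneg)
  ultimately show ?thesis by linarith
next
  case False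
  then have pos: "f i > 0" if "i \<in> I" for i using assms(3) that by (metis order_le_less)
  define m where "m = (\<Sum>i\<in>I. f i) / card I"
  have c: "card I > 0" using assms(1,2) by (simp add: card_gt_0_iff)
  have m: "m > 0" unfolding m_def using pos assms(1,2) c by (simp add: sum_pos)
  have "(\<Prod>i\<in>I. f i / m) \<le> (\<Prod>i\<in>I. exp (f i / m - 1))"
    using pos m exp_ge_add_one_self[of "f _ / m - 1"] by (intro prod_mono) (auto intro!: divide_nonneg_pos less_imp_le)
  also have "\<dots> = exp ((\<Sum>i\<in>I. f i) / m - card I)"
    by (simp add: sum_subtractf sum_divide_distrib flip: exp_sum[OF assms(1)])
  also have "(\<Sum>i\<in>I. f i) / m = card I" using m c by (simp add: m_def field_simps)
  finally have "(\<Prod>i\<in>I. f i) / m ^ card I \<le> 1" by (simp add: prod_dividef)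
  then show ?thesis using m by (simp add: m_def[symmetric])
qed

text \<open>The columns of \<open>U\<close> are orthogonal for \<open>Q\<close>, so the sum on the
  right is the trace of \<open>Q' Q^-1\<close>.\<close>

lemma det_trace_inequality:
  fixes Q Q' U :: "real^'n^'n"
  assumes Q: "pqf Q" and Q': "pqf Q'" and U: "det U \<noteq> 0"
    and orth: "\<And>i j. i \<noteq> j \<Longrightarrow> (transpose U ** Q ** U) $ i $ j = 0"
  shows "det Q' / det Q \<le> 
    ((\<Sum>i\<in>UNIV. quad_form Q' (U *v axis i 1) / quad_form Q (U *v axis i 1)) / CARD('n)) ^ CARD('n)"
proof -
  let ?A = "transpose U ** Q ** U" and ?A' = "transpose U ** Q' ** U"
  have A: "pqf ?A" "pqf ?A'" by (rule pqf_congruence[OF _ U], fact)+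
  have diag: "?A $ i $ i = quad_form Q (U *v axis i 1)" "?A' $ i $ i = quad_form Q' (U *v axis i 1)" for i
    by (simp_all add: quad_form_congruence flip: quad_form_axis)
  have "det ?A = (\<Prod>i\<in>UNIV. ?A $ i $ i)" by (rule det_diagonal) (rule orth)
  moreover have "det ?A' \<le> (\<Prod>i\<in>UNIV. ?A' $ i $ i)" by (rule Hadamard[OF A(2)])
  ultimately have "det ?A' / det ?A \<le> (\<Prod>i\<in>UNIV. ?A' $ i $ i / ?A $ i $ i)"
    using pqf_det_pos[OF A(1)] by (simp add: prod_dividef divide_right_mono)
  also have "\<dots> \<le> ((\<Sum>i\<in>UNIV. ?A' $ i $ i / ?A $ i $ i) / CARD('n)) ^ CARD('n)"
    using pqf_diagonal_pos[OF A(1)] pqf_diagonal_pos[OF A(2)]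
    by (intro prod_le_mean_power) (auto simp: less_imp_le)
  finally have "det ?A' / det ?A \<le> ((\<Sum>i\<in>UNIV. ?A' $ i $ i / ?A $ i $ i) / CARD('n)) ^ CARD('n)" .
  moreover have "det ?A' / det ?A = det Q' / det Q" using U by (simp add: det_mul det_transpose)
  ultimately show ?thesis by (simp add: diag)
qed

text \<open>The injection \<open>f\<close> supplies the order of the indices. A permutation that
  never decreases \<open>f\<close> is the identity, because it preserves the sum of
  \<open>f\<close>.\<close>

lemma det_triangular:
  fixes A :: "real^'n^'n" and f :: "'n \<Rightarrow> nat"
  assumes f: "inj f" and zero: "\<And>i j. f j < f i \<Longrightarrow> A $ i $ j = 0"
  shows "det A = (\<Prod>i\<in>UNIV. A $ i $ i)"
proof -
  have "(\<Sum>p | p permutes UNIV. of_int (sign p) * (\<Prod>i\<in>UNIV. A $ i $ p i)) =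
     (\<Sum>p\<in>{id}. of_int (sign p) * (\<Prod>i\<in>UNIV. A $ i $ p i))"
  proof (rule sum.mono_neutral_right)
    show "\<forall>p\<in>{p. p permutes UNIV} - {id}. of_int (sign p) * (\<Prod>i\<in>UNIV. A $ i $ p i) = 0"
    proof
      fix p assume p: "p \<in> {p. p permutes (UNIV::'n set)} - {id}"
      have "\<exists>i. f (p i) < f i"
      proof (rule ccontr)
        assume "\<not> ?thesis"
        then have le: "f i \<le> f (p i)" for i by (simp add: not_less)
        have "(\<Sum>i\<in>UNIV. f (p i)) = (\<Sum>i\<in>UNIV. f i)"
          using p by (intro sum.reindex_bij_betw permutes_bij) auto
        then have "f (p i) = f i" for i
          using le sum_strict_mono_ex1[of UNIV f "\<lambda>i. f (p i)"] by (metis UNIV_I finite less_irrefl order_le_less)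
        then have "p = id" using f by (auto simp: inj_def)
        then show False using p by simp
      qed
      then obtain i where "A $ i $ p i = 0" using zero by blast
      then have "(\<Prod>i\<in>UNIV. A $ i $ p i) = 0" by (intro prod_zero) auto
      then show "of_int (sign p) * (\<Prod>i\<in>UNIV. A $ i $ p i) = 0" by simp
    qed
  qed (auto simp: finite_permutations permutes_id)
  then show ?thesis by (simp add: det_def)
qed

lemma matrix_congruence_entry: "(transpose U ** Q ** U) $ i $ j = (U *v axis i 1) \<bullet> (Q *v (U *v axis j 1))"
  for U :: "real^'n^'n"
proof -
  have "(transpose U ** Q ** U) $ i $ j = axis i 1 \<bullet> ((transpose U ** Q ** U) *v axis j 1)"
    by (simp add: matrix_vector_mult_basis column_def inner_axis inner_commute[of "axis i 1"])
  also have "\<dots> = axis i 1 \<bullet> (transpose U *v (Q *v (U *v axis j 1)))"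
    by (simp add: matrix_vector_mul_assoc matrix_mul_assoc)
  also have "\<dots> = (U *v axis i 1) \<bullet> (Q *v (U *v axis j 1))"
    by (metis dot_lmul_matrix inner_commute transpose_matrix_vector)
  finally show ?thesis .
qed

section \<open>Coordinates and symmetries\<close>

lemma exhaust_7:
  fixes x :: 7
  shows "x = 1 \<or> x = 2 \<or> x = 3 \<or> x = 4 \<or> x = 5 \<or> x = 6 \<or> x = 7"
proof (induct x)
  case (of_int z)
  then have "z = 0 \<or> z = 1 \<or> z = 2 \<or> z = 3 \<or> z = 4 \<or> z = 5 \<or> z = 6" by fastforce
  then show ?case by auto
qed

lemma forall_7: "(\<forall>i::7. P i) \<longleftrightarrow> P 1 \<and> P 2 \<and> P 3 \<and> P 4 \<and> P 5 \<and> P 6 \<and> P 7"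
  by (metis exhaust_7)

lemma UNIV_7: "UNIV = {1, 2, 3, 4, 5, 6, 7::7}"
  using exhaust_7 by auto

lemma sum_7: "sum f (UNIV::7 set) = f 1 + f 2 + f 3 + f 4 + f 5 + f 6 + f 7"
  unfolding UNIV_7 by (simp add: ac_simps)

lemma vector_7 [simp]:
  "(vector [a,b,c,d,e,f,g] :: ('a::zero)^7) $ 1 = a"
  "(vector [a,b,c,d,e,f,g] :: ('a::zero)^7) $ 2 = b"
  "(vector [a,b,c,d,e,f,g] :: ('a::zero)^7) $ 3 = c"
  "(vector [a,b,c,d,e,f,g] :: ('a::zero)^7) $ 4 = d"
  "(vector [a,b,c,d,e,f,g] :: ('a::zero)^7) $ 5 = e"
  "(vector [a,b,c,d,e,f,g] :: ('a::zero)^7) $ 6 = f"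
  "(vector [a,b,c,d,e,f,g] :: ('a::zero)^7) $ 7 = g"
  unfolding vector_def by simp_all

text \<open>In the type \<open>7\<close> the last index \<open>7\<close> is \<open>0\<close>.\<close>

definition coord :: "nat \<Rightarrow> 7" where
  "coord k = of_nat (Suc k)"

lemma lessThan_7: "{..<7::nat} = {0, 1, 2, 3, 4, 5, 6}"
  by auto

lemma coord_simps:
  "coord 0 = 1" "coord 1 = 2" "coord (Suc 0) = 2" "coord 2 = 3" "coord 3 = 4" "coord 4 = 5" "coord 5 = 6" "coord 6 = 7"
  by (simp_all add: coord_def)

lemma bij_betw_coord: "bij_betw coord {..<7} UNIV"
proof (rule bij_betw_imageI)
  show "inj_on coord {..<7}" by (simp add: lessThan_7 coord_simps)
  show "coord ` {..<7} = UNIV" unfolding lessThan_7 UNIV_7 by (auto simp: coord_simps)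
qed

definition index :: "7 \<Rightarrow> nat" where
  "index = inv_into {..<7} coord"

lemma index_coord [simp]: "k < 7 \<Longrightarrow> index (coord k) = k"
  unfolding index_def using bij_betw_coord by (simp add: bij_betw_inv_into_left)

lemma coord_index [simp]: "coord (index i) = i"
  unfolding index_def using bij_betw_coord by (simp add: bij_betw_inv_into_right)

lemma index_less [simp]: "index i < 7"
  using bij_betw_coord unfolding index_def bij_betw_def by (metis UNIV_I inv_into_into lessThan_iff)

lemma sum_coord: "sum f (UNIV::7 set) = (\<Sum>k<7. f (coord k))"
  by (rule sum.reindex_bij_betw[OF bij_betw_coord, symmetric])

lemma prod_coord: "prod f (UNIV::7 set) = (\<Prod>k<7. f (coord k))"
  by (rule prod.reindex_bij_betw[OF bij_betw_coord, symmetric])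

definition ivec :: "int list \<Rightarrow> real^7" where
  "ivec l = (\<chi> i. of_int (l ! index i))"

lemma ivec_coord [simp]: "k < 7 \<Longrightarrow> ivec l $ coord k = of_int (l ! k)"
  by (simp add: ivec_def)

lemma ivec_int_lattice: "ivec l \<in> int_lattice"
  by (simp add: ivec_def int_lattice_def)

text \<open>
  The vectors of \<open>Q7c\<close>-norm 12 are the seven vectors \<open>e\<^sub>1, \<dots>, e\<^sub>6, (-1, -1, -1, -1, -1, 2, 3)\<close>, up to
  sign. Their Gram matrix is \<open>11 I + J\<close>, where \<open>J\<close> is the all-ones matrix, and they generate a
  sublattice of index 3. The coordinates \<open>to_frame v\<close> are three times the coordinates with respect
  to these vectors; lattice points become the integer vectors whose entries are all congruent
  modulo 3, and the symmetries of \<open>Q7c\<close> become signed permutations of the coordinates.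
\<close>

definition twist :: "real^7" where
  "twist = vector [1, 1, 1, 1, 1, -2, -2]"

definition to_frame :: "real^7 \<Rightarrow> real^7" where
  "to_frame v = 3 *\<^sub>R v + (v $ 7) *\<^sub>R twist"

definition of_frame :: "real^7 \<Rightarrow> real^7" where
  "of_frame x = (1/3) *\<^sub>R (x - (x $ 7) *\<^sub>R twist)"

lemma twist_7 [simp]: "twist $ 7 = -2"
  by (simp add: twist_def)

lemma linear_to_frame: "linear to_frame"
  unfolding to_frame_def by (rule linearI) (auto simp: algebra_simps)

lemma linear_of_frame: "linear of_frame"
  unfolding of_frame_def by (rule linearI) (auto simp: algebra_simps)

lemma of_frame_to_frame [simp]: "of_frame (to_frame v) = v"
  by (simp add: of_frame_def to_frame_def vec_eq_iff)

lemma to_frame_of_frame [simp]: "to_frame (of_frame x) = x"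
  by (simp add: of_frame_def to_frame_def vec_eq_iff field_simps)

text \<open>This is the Gram matrix \<open>11 I + J\<close>; the denominator comes from the factor 3
  in \<open>to_frame\<close>.\<close>

lemma inner_Q7c:
  "v \<bullet> (Q7c *v w) = (11 * (to_frame v \<bullet> to_frame w) + (\<Sum>i\<in>UNIV. to_frame v $ i) * (\<Sum>i\<in>UNIV. to_frame w $ i)) / 9"
  by (simp add: inner_vec_def matrix_vector_mult_def sum_7 Q7c_def to_frame_def twist_def field_simps)

lemma quad_form_Q7c:
  "quad_form Q7c v = (11 * (\<Sum>i\<in>UNIV. (to_frame v $ i)\<^sup>2) + (\<Sum>i\<in>UNIV. to_frame v $ i)\<^sup>2) / 9"
  unfolding quad_form_def inner_Q7c by (simp add: inner_vec_def power2_eq_square)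

lemma transpose_Q7c: "transpose Q7c = Q7c"
  unfolding vec_eq_iff forall_7 transpose_def by (simp add: Q7c_def)

lemma pqf_Q7c: "pqf Q7c"
  unfolding pqf_def
proof (intro conjI allI impI transpose_Q7c)
  fix v :: "real^7" assume "v \<noteq> 0"
  then have "to_frame v \<noteq> 0" using of_frame_to_frame[of v] linear_0[OF linear_of_frame] by metis
  then obtain i where "to_frame v $ i \<noteq> 0" by (auto simp: vec_eq_iff)
  then have "(\<Sum>i\<in>UNIV. (to_frame v $ i)\<^sup>2) > 0" by (intro sum_pos2[of _ i]) auto
  then show "quad_form Q7c v > 0" unfolding quad_form_Q7c by (intro divide_pos_pos add_pos_nonneg) auto
qed

definition permute :: "(7 \<Rightarrow> 7) \<Rightarrow> real^7 \<Rightarrow> real^7" where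
  "permute \<sigma> x = (\<chi> i. x $ \<sigma> i)"

lemma linear_permute: "linear (permute \<sigma>)"
  by (rule linearI) (auto simp: permute_def vec_eq_iff)

definition act :: "(7 \<Rightarrow> 7) \<Rightarrow> real \<Rightarrow> real^7 \<Rightarrow> real^7" where
  "act \<sigma> \<epsilon> v = of_frame (\<epsilon> *\<^sub>R permute \<sigma> (to_frame v))"

definition symmetries :: "(real^7 \<Rightarrow> real^7) set" where
  "symmetries = {act \<sigma> \<epsilon> | \<sigma> \<epsilon>. bij \<sigma> \<and> \<epsilon> \<in> {1, -1}}"

lemma act_symmetries: "bij \<sigma> \<Longrightarrow> act \<sigma> 1 \<in> symmetries"
  unfolding symmetries_def by blast

lemma finite_symmetries: "finite symmetries"
proof -
  have "symmetries \<subseteq> (\<lambda>(\<sigma>, \<epsilon>). act \<sigma> \<epsilon>) ` (UNIV \<times> {1, -1})"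
    unfolding symmetries_def by auto
  then show ?thesis by (rule finite_subset) simp
qed

lemma linear_act: "linear (act \<sigma> \<epsilon>)"
proof -
  have "linear (\<lambda>x. of_frame (\<epsilon> *\<^sub>R permute \<sigma> (to_frame x)))"
    using linear_compose[OF linear_compose[OF linear_to_frame linear_compose_scale_right[OF linear_permute]] linear_of_frame]
    by (simp add: o_def)
  then show ?thesis by (simp add: act_def[abs_def])
qed

lemma to_frame_act: "to_frame (act \<sigma> \<epsilon> v) = \<epsilon> *\<^sub>R permute \<sigma> (to_frame v)"
  by (simp add: act_def)

lemma act_act: "act \<sigma> \<epsilon> (act \<tau> \<delta> v) = act (\<tau> \<circ> \<sigma>) (\<epsilon> * \<delta>) v"
proof -
  have "permute \<sigma> (\<delta> *\<^sub>R permute \<tau> x) = \<delta> *\<^sub>R permute (\<tau> \<circ> \<sigma>) x" for x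
    by (simp add: permute_def vec_eq_iff)
  then show ?thesis unfolding act_def[of \<sigma>] to_frame_act by (simp add: act_def)
qed

lemma act_id [simp]: "act id 1 v = v"
  by (simp add: act_def permute_def)

lemma symmetries_compose: "g \<in> symmetries \<Longrightarrow> h \<in> symmetries \<Longrightarrow> (\<lambda>x. g (h x)) \<in> symmetries"
  unfolding symmetries_def by (clarsimp simp: act_act) (metis bij_comp mult_1 mult_minus1 minus_minus)

lemma symmetries_linear: "g \<in> symmetries \<Longrightarrow> linear g"
  unfolding symmetries_def using linear_act by blast

lemma symmetries_inverse:
  assumes "g \<in> symmetries"
  obtains h where "h \<in> symmetries" "\<And>x. h (g x) = x" "\<And>x. g (h x) = x"
proof -
  obtain \<sigma> \<epsilon> where g: "g = act \<sigma> \<epsilon>" "bij \<sigma>" "\<epsilon> = 1 \<or> \<epsilon> = -1" using assms unfolding symmetries_def by blast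
  have "\<epsilon> * \<epsilon> = 1" using g(3) by auto
  moreover have "\<sigma> \<circ> inv \<sigma> = id" "inv \<sigma> \<circ> \<sigma> = id" using g(2) 
    by (auto simp: bij_def surj_iff inj_iff)
  ultimately have "act (inv \<sigma>) \<epsilon> (g x) = x" "g (act (inv \<sigma>) \<epsilon> x) = x" for x
    unfolding g act_act by simp_all
  moreover have "act (inv \<sigma>) \<epsilon> \<in> symmetries" 
    using g(2,3) bij_imp_bij_inv unfolding symmetries_def by blast
  ultimately show ?thesis using that by blast
qed

text \<open>All frame coordinates of a lattice point are congruent to \<open>v $ 7\<close> modulo 3.
  Signed permutations keep them congruent to each other, and \<open>of_frame\<close> is integral on
  such vectors.\<close>

lemma symmetries_int_lattice:
  assumes "g \<in> symmetries" "v \<in> int_lattice" shows "g v \<in> int_lattice"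
proof -
  obtain \<sigma> \<epsilon> where g: "g = act \<sigma> \<epsilon>" "\<epsilon> = 1 \<or> \<epsilon> = -1" using assms unfolding symmetries_def by blast
  have "\<exists>m. to_frame v $ i = v $ 7 + 3 * of_int m" for i
  proof -
    have "v $ i \<in> \<int>" "v $ 7 \<in> \<int>" using assms by (auto simp: int_lattice_def)
    then obtain a b where ab: "v $ i = of_int a" "v $ 7 = of_int b" by (auto elim!: Ints_cases)
    have "twist $ i = 1 \<or> twist $ i = -2" using exhaust_7[of i] by (auto simp: twist_def)
    then show ?thesis
    proof
      assume "twist $ i = 1" then show ?thesis by (intro exI[of _ a]) (simp add: to_frame_def ab)
    next
      assume "twist $ i = -2" then show ?thesis by (intro exI[of _ "a - b"]) (simp add: to_frame_def ab)
    qed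
  qed
  then obtain m where m: "\<And>i. to_frame v $ i = v $ 7 + 3 * of_int (m i)" by metis
  obtain b where b: "v $ 7 = of_int b" using assms by (auto simp: int_lattice_def elim!: Ints_cases)
  have "of_frame (permute \<sigma> (to_frame v)) $ i \<in> \<int>" for i
  proof -
    have t: "twist $ i = 1 \<or> twist $ i = -2" using exhaust_7[of i] by (auto simp: twist_def)
    have "of_frame (permute \<sigma> (to_frame v)) $ i = of_int (if twist $ i = 1 then m (\<sigma> i) - m (\<sigma> 7) else b + m (\<sigma> i) + 2 * m (\<sigma> 7))"
      using t by (auto simp: of_frame_def permute_def m b)
    then show ?thesis by (metis Ints_of_int)
  qed
  then show ?thesis using g by (auto simp: act_def int_lattice_def linear_neg[OF linear_of_frame])
qed

lemma symmetries_quad_form: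
  assumes "g \<in> symmetries" shows "quad_form Q7c (g v) = quad_form Q7c v"
proof -
  obtain \<sigma> \<epsilon> where g: "g = act \<sigma> \<epsilon>" "bij \<sigma>" "\<epsilon> = 1 \<or> \<epsilon> = -1" using assms unfolding symmetries_def by blast
  have "(\<Sum>i\<in>UNIV. f (\<sigma> i)) = (\<Sum>i\<in>UNIV. f i)" for f :: "7 \<Rightarrow> real"
    by (rule sum.reindex_bij_betw[OF g(2)])
  note * = this[of "\<lambda>i. to_frame v $ i"] this[of "\<lambda>i. (to_frame v $ i)\<^sup>2"]
  show ?thesis unfolding quad_form_Q7c using g(3) 
    by (auto simp: g(1) act_def permute_def sum_negf *)
qed

lemma sphere_power_symmetries:
  assumes g: "g \<in> symmetries" and W: "frame W"
  shows "frame (g ` W)" "w \<in> W \<Longrightarrow> bary (g ` W) (g w) (g x) = bary W w x"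
    "sphere_power Q7c (g ` W) (g x) = sphere_power Q7c W x"
proof -
  obtain h where h: "linear h" "\<And>x. h (g x) = x" "\<And>x. g (h x) = x"
    using symmetries_inverse[OF g] symmetries_linear by metis
  show "frame (g ` W)" using frame_image(1)[OF W symmetries_linear[OF g] h, of 0] by simp
  show b: "bary (g ` W) (g w) (g x) = bary W w x" if "w \<in> W" for w
    using frame_image(2)[OF W symmetries_linear[OF g] h that, of 0 x] by simp
  have "inj_on g W" by (metis h(2) inj_onI)
  then show "sphere_power Q7c (g ` W) (g x) = sphere_power Q7c W x"
    unfolding sphere_power_def by (simp add: sum.reindex b symmetries_quad_form[OF g])
qed

section \<open>The three orbits of Delone simplices\<close>

definition affine_eval :: "int list \<Rightarrow> real^7 \<Rightarrow> real" where
  "affine_eval b x = of_int (b ! 0) + (\<Sum>k<7. of_int (b ! Suc k) * x $ coord k)"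

definition affine_eval_int :: "int list \<Rightarrow> int list \<Rightarrow> int" where
  "affine_eval_int b l = b ! 0 + (\<Sum>k<7. b ! Suc k * l ! k)"

lemma affine_eval_ivec: "affine_eval b (ivec l) = of_int (affine_eval_int b l)"
  by (simp add: affine_eval_def affine_eval_int_def)

lemma affine_eval_Ints: "x \<in> int_lattice \<Longrightarrow> affine_eval b x \<in> \<int>"
  by (auto simp: affine_eval_def int_lattice_def intro!: Ints_add Ints_sum Ints_mult)

lemma affine_fun_affine_eval: "affine_fun (affine_eval b)"
proof -
  have "linear (\<lambda>x::real^7. x $ i)" for i by (rule linearI) auto
  then show ?thesis unfolding affine_eval_def[abs_def]
    by (intro affine_fun_add affine_fun_const affine_fun_sum affine_fun_cmult affine_fun_linear)
qed

definition vertices :: "int list list \<Rightarrow> (real^7) set" where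
  "vertices W = (\<lambda>i. ivec (W ! i)) ` {..<8}"

text \<open>An integer certificate that the rows of \<open>B\<close> (constant term first) are the
  barycentric coordinates of \<open>W\<close>: the frame conditions, compared coefficient by
  coefficient. Integrality of \<open>B\<close> yields unimodularity.\<close>

definition dual_data :: "int list list \<Rightarrow> int list list \<Rightarrow> bool" where
  "dual_data W B \<longleftrightarrow> (\<forall>i<8. \<forall>j<8. affine_eval_int (B ! i) (W ! j) = of_bool (i = j)) \<and>
     (\<Sum>i<8. B ! i ! 0) = 1 \<and> (\<forall>k<7. (\<Sum>i<8. B ! i ! Suc k) = 0) \<and>
     (\<forall>l<7. (\<Sum>i<8. B ! i ! 0 * W ! i ! l) = 0) \<and>
     (\<forall>k<7. \<forall>l<7. (\<Sum>i<8. B ! i ! Suc k * W ! i ! l) = of_bool (k = l))"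

lemma vec_eq_coordI: "(\<And>k. k < 7 \<Longrightarrow> x $ coord k = y $ coord k) \<Longrightarrow> x = (y :: 'a^7)"
  by (metis vec_eq_iff coord_index index_less)

lemma
  assumes "dual_data W B"
  shows frame_vertices: "frame (vertices W)"
    and bary_vertices: "i < 8 \<Longrightarrow> bary (vertices W) (ivec (W ! i)) x = affine_eval (B ! i) x"
    and inj_vertices: "inj_on (\<lambda>i. ivec (W ! i)) {..<8}"
proof -
  note D = assms[unfolded dual_data_def]
  have d: "affine_eval (B ! i) (ivec (W ! j)) = of_bool (i = j)" if "i < 8" "j < 8" for i j
    using D that by (simp add: affine_eval_ivec)
  have s1: "(\<Sum>i<8. affine_eval (B ! i) x) = 1" for x
  proof -
    have "(\<Sum>i<8. affine_eval (B ! i) x) = of_int (\<Sum>i<8. B ! i ! 0) + (\<Sum>k<7. of_int (\<Sum>i<8. B ! i ! Suc k) * x $ coord k)"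
      unfolding affine_eval_def sum.distrib
      by (subst sum.swap) (simp add: sum_distrib_right)
    then show ?thesis using D by simp
  qed
  have sx: "(\<Sum>i<8. affine_eval (B ! i) x *\<^sub>R ivec (W ! i)) = x" for x
  proof (rule vec_eq_coordI)
    fix l :: nat assume l: "l < 7"
    have "(\<Sum>i<8. affine_eval (B ! i) x *\<^sub>R ivec (W ! i)) $ coord l =
       (\<Sum>i<8. (of_int (B ! i ! 0) + (\<Sum>k<7. of_int (B ! i ! Suc k) * x $ coord k)) * of_int (W ! i ! l))"
      using l by (simp add: affine_eval_def)
    also have "\<dots> = of_int (\<Sum>i<8. B ! i ! 0 * W ! i ! l) 
        + (\<Sum>i<8. \<Sum>k<7. of_int (B ! i ! Suc k * W ! i ! l) * x $ coord k)"
      by (simp add: distrib_right sum.distrib) (simp add: sum_distrib_right sum_distrib_left mult_ac)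
    also have "(\<Sum>i<8. \<Sum>k<7. of_int (B ! i ! Suc k * W ! i ! l) * x $ coord k) =
        (\<Sum>k<7. of_int (\<Sum>i<8. B ! i ! Suc k * W ! i ! l) * x $ coord k)"
      by (subst sum.swap) (simp add: sum_distrib_right)
    also have "\<dots> = (\<Sum>k<7. of_bool (k = l) * x $ coord k)"
      using D l by (intro sum.cong refl) auto
    finally show "(\<Sum>i<8. affine_eval (B ! i) x *\<^sub>R ivec (W ! i)) $ coord l = x $ coord l"
      using D l by simp
  qed
  note * = frame_indexed[of 8 "\<lambda>i. affine_eval (B ! i)" "\<lambda>i. ivec (W ! i)", OF affine_fun_affine_eval d s1 sx]
  show "frame (vertices W)" unfolding vertices_def by (rule *(1)) auto
  show "inj_on (\<lambda>i. ivec (W ! i)) {..<8}" by (rule *(3)) auto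
  show "bary (vertices W) (ivec (W ! i)) x = affine_eval (B ! i) x" if "i < 8"
    unfolding vertices_def by (rule *(2)) (use that in auto)
qed

definition to_frame_int :: "int list \<Rightarrow> int list" where
  "to_frame_int l = map (\<lambda>k. 3 * l ! k + l ! 6 * [1, 1, 1, 1, 1, -2, -2] ! k) [0..<7]"

lemma to_frame_ivec: "to_frame (ivec l) = ivec (to_frame_int l)"
proof (rule vec_eq_coordI)
  fix k :: nat assume k: "k < 7"
  have "twist $ coord k = of_int ([1, 1, 1, 1, 1, -2, -2] ! k)"
  proof -
    have "k \<in> {0, 1, 2, 3, 4, 5, 6}" using k lessThan_7 by blast
    then show ?thesis by (elim insertE emptyE) (simp_all add: twist_def coord_simps)
  qed
  moreover have "ivec l $ 7 = of_int (l ! 6)" using ivec_coord[of 6 l] by (simp add: coord_simps)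
  ultimately show "to_frame (ivec l) $ coord k = ivec (to_frame_int l) $ coord k"
    using k by (simp add: to_frame_def to_frame_int_def)
qed

text \<open>Nine times the form \<open>Q7c\<close>, so that the checks by evaluation stay in the
  integers.\<close>

definition norm9 :: "int list \<Rightarrow> int" where
  "norm9 l = 11 * (\<Sum>k<7. (to_frame_int l ! k)\<^sup>2) + (\<Sum>k<7. to_frame_int l ! k)\<^sup>2"

lemma quad_form_ivec: "quad_form Q7c (ivec l) = of_int (norm9 l) / 9"
  by (simp add: quad_form_Q7c to_frame_ivec sum_coord norm9_def)

text \<open>
  The entry \<open>(u, W', p, \<epsilon>, t)\<close> says that exchanging the vertex \<open>i\<close> of \<open>W\<close> for \<open>u\<close> gives the image of
  \<open>W'\<close> under the coordinate permutation \<open>p\<close>, the sign \<open>\<epsilon>\<close> and the translation by \<open>t\<close>.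
\<close>

definition neighbour_data :: 
  "int list list \<Rightarrow> int list list \<Rightarrow> nat \<Rightarrow> int list \<times> int list list \<times> nat list \<times> int \<times> int list \<Rightarrow> bool" where
  "neighbour_data W B i = (\<lambda>(u, W', p, \<epsilon>, t). affine_eval_int (B ! i) u < 0 \<and>
     (\<Sum>j<8. affine_eval_int (B ! j) u * norm9 (W ! j)) < norm9 u \<and>
     distinct p \<and> set p = {..<7} \<and> (\<epsilon> = 1 \<or> \<epsilon> = -1) \<and>
     (\<lambda>j. to_frame_int (map (\<lambda>k. W[i := u] ! j ! k - t ! k) [0..<7])) ` {..<8} =
     (\<lambda>j. map (\<lambda>k. \<epsilon> * to_frame_int (W' ! j) ! (p ! k)) [0..<7]) ` {..<8})"

definition list_perm :: "nat list \<Rightarrow> 7 \<Rightarrow> 7" where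
  "list_perm p i = coord (p ! index i)"

lemma length_perm7: "distinct p \<Longrightarrow> set p = {..<7::nat} \<Longrightarrow> length p = 7"
  by (metis card_lessThan distinct_card)

lemma bij_list_perm:
  assumes "distinct p" "set p = {..<7}"
  shows "bij (list_perm p)"
proof -
  note l = length_perm7[OF assms]
  have "bij_betw (\<lambda>k. p ! k) {..<7} {..<7}"
    by (rule bij_betw_nth[OF assms(1)]) (simp_all only: l assms(2))
  moreover have "bij_betw index UNIV {..<7}" unfolding index_def 
    by (rule bij_betw_inv_into[OF bij_betw_coord])
  ultimately have "bij_betw (coord \<circ> (\<lambda>k. p ! k) \<circ> index) UNIV UNIV"
    using bij_betw_coord by (meson bij_betw_trans)
  then show ?thesis by (simp add: list_perm_def[abs_def] o_def)
qed

lemma permute_ivec: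
  assumes "distinct p" "set p = {..<7}"
  shows "permute (list_perm p) (ivec l) = ivec (map (\<lambda>k. l ! (p ! k)) [0..<7])"
proof (rule vec_eq_coordI)
  fix k :: nat assume k: "k < 7"
  then have "p ! k < 7" using assms length_perm7[OF assms] nth_mem[of k p] by auto
  then show "permute (list_perm p) (ivec l) $ coord k = ivec (map (\<lambda>k. l ! (p ! k)) [0..<7]) $ coord k"
    using k by (simp add: permute_def list_perm_def)
qed

lemma neighbour:
  assumes d: "dual_data W B" and i: "i < 8" "i < length W" and n: "neighbour_data W B i (u, W', p, \<epsilon>, t)"
  shows "\<exists>g\<in>symmetries. insert (ivec u) (vertices W - {ivec (W ! i)}) = (+) (ivec t) ` g ` vertices W'"
    "bary (vertices W) (ivec (W ! i)) (ivec u) < 0" "sphere_power Q7c (vertices W) (ivec u) > 0"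
proof -
  note n' = n[unfolded neighbour_data_def, simplified]
  show "bary (vertices W) (ivec (W ! i)) (ivec u) < 0"
    using n' i(1) by (simp add: bary_vertices[OF d] affine_eval_ivec)
  have "sphere_power Q7c (vertices W) (ivec u) = quad_form Q7c (ivec u) -
     (\<Sum>j<8. affine_eval (B ! j) (ivec u) * quad_form Q7c (ivec (W ! j)))"
    unfolding sphere_power_def
    by (subst vertices_def, subst sum.reindex[OF inj_vertices[OF d]]) (simp add: bary_vertices[OF d])
  also have "\<dots> = of_int (norm9 u - (\<Sum>j<8. affine_eval_int (B ! j) u * norm9 (W ! j))) / 9"
    by (simp add: affine_eval_ivec quad_form_ivec diff_divide_distrib sum_divide_distrib)
  also have "\<dots> > 0"
    using n' by (intro divide_pos_pos) (simp_all only: of_int_0_less_iff, simp_all)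
  finally show "sphere_power Q7c (vertices W) (ivec u) > 0" .
  have p: "distinct p" "set p = {..<7}" using n' by auto
  define g where "g = act (list_perm p) (of_int \<epsilon>)"
  have gs: "g \<in> symmetries" using n' bij_list_perm[OF p] unfolding symmetries_def g_def by force
  have l: "insert (ivec u) (vertices W - {ivec (W ! i)}) = (\<lambda>j. ivec (W[i := u] ! j)) ` {..<8}"
  proof -
    have "{..<8} = insert i ({..<8} - {i})" using i by auto
    then have "(\<lambda>j. ivec (W[i := u] ! j)) ` {..<8} = 
       (\<lambda>j. ivec (W[i := u] ! j)) ` insert i ({..<8} - {i})"
      by (rule arg_cong)
    also have "\<dots> = insert (ivec u) ((\<lambda>j. ivec (W[i := u] ! j)) ` ({..<8} - {i}))"
      using i(2) by (simp only: image_insert nth_list_update_eq)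
    also have "(\<lambda>j. ivec (W[i := u] ! j)) ` ({..<8} - {i}) = (\<lambda>j. ivec (W ! j)) ` ({..<8} - {i})"
      by (intro image_cong) auto
    also have "\<dots> = vertices W - {ivec (W ! i)}"
      unfolding vertices_def using i(1) inj_on_image_set_diff[OF inj_vertices[OF d], of "{..<8}" "{i}"] by simp
    finally show ?thesis by simp
  qed
  have sub: "ivec (map (\<lambda>k. a ! k - b ! k) [0..<7]) = ivec a - ivec b" for a b
    by (rule vec_eq_coordI) simp
  \<comment> \<open>The vertex sets are compared in frame coordinates, where the symmetry is a
    signed permutation; injectivity of \<open>to_frame\<close> transfers the equality back.\<close>
  have "(\<lambda>j. to_frame (ivec (W[i := u] ! j) - ivec t)) ` {..<8} = 
    ivec ` (\<lambda>j. to_frame_int (map (\<lambda>k. W[i := u] ! j ! k - t ! k) [0..<7])) ` {..<8}"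
    by (simp add: image_image to_frame_ivec flip: sub)
  also have "\<dots> = ivec ` (\<lambda>j. map (\<lambda>k. \<epsilon> * to_frame_int (W' ! j) ! (p ! k)) [0..<7]) ` {..<8}"
    using n' by simp
  also have "\<dots> = (\<lambda>j. to_frame (g (ivec (W' ! j)))) ` {..<8}"
    unfolding image_image
  proof (intro image_cong refl)
    fix j
    have "ivec (map (\<lambda>k. \<epsilon> * to_frame_int (W' ! j) ! (p ! k)) [0..<7]) = 
        of_int \<epsilon> *\<^sub>R ivec (map (\<lambda>k. to_frame_int (W' ! j) ! (p ! k)) [0..<7])"
      by (rule vec_eq_coordI) simp
    then show "ivec (map (\<lambda>k. \<epsilon> * to_frame_int (W' ! j) ! (p ! k)) [0..<7]) = to_frame (g (ivec (W' ! j)))"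
      by (simp add: g_def to_frame_act to_frame_ivec permute_ivec[OF p])
  qed
  finally have e: "to_frame ` (\<lambda>j. ivec (W[i := u] ! j) - ivec t) ` {..<8} = to_frame ` g ` vertices W'"
    by (simp add: image_image vertices_def)
  have "inj to_frame" by (metis of_frame_to_frame injI)
  then have "(\<lambda>j. ivec (W[i := u] ! j) - ivec t) ` {..<8} = g ` vertices W'"
    using e by (simp add: inj_image_eq_iff)
  then have "(+) (ivec t) ` (\<lambda>j. ivec (W[i := u] ! j) - ivec t) ` {..<8} = (+) (ivec t) ` g ` vertices W'"
    by simp
  then have "insert (ivec u) (vertices W - {ivec (W ! i)}) = (+) (ivec t) ` g ` vertices W'"
    unfolding l by (simp add: image_image)
  then show "\<exists>g\<in>symmetries. insert (ivec u) (vertices W - {ivec (W ! i)}) = (+) (ivec t) ` g ` vertices W'"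
    using gs by blast
qed

section \<open>Vertices, dual functions and facet neighbours of the three simplices\<close>

definition simplex_A :: "int list list" where
  "simplex_A = [[0, 0, 0, 0, 1, 0, 0],
    [0, 0, 0, 0, 0, 0, 1],
    [0, 0, 0, 0, 0, 1, 1],
    [0, 0, 0, 0, 0, 0, 0],
    [0, 0, 1, 0, 0, 0, 0],
    [0, -1, 0, 0, 0, 1, 1],
    [1, 0, 1, 0, 1, -1, -1],
    [0, -1, 0, -1, 0, 1, 2]]"

text \<open>The neighbour of A across the facet opposite vertex 2, counting from 0.\<close>

definition simplex_B :: "int list list" where
  "simplex_B = [[0, 0, 0, 0, 1, 0, 0],
    [0, 0, 0, 0, 0, 0, 1],
    [0, -1, 0, 0, 0, 0, 1],
    [0, 0, 0, 0, 0, 0, 0],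
    [0, 0, 1, 0, 0, 0, 0],
    [0, -1, 0, 0, 0, 1, 1],
    [1, 0, 1, 0, 1, -1, -1],
    [0, -1, 0, -1, 0, 1, 2]]"

text \<open>The neighbour of B across the facet opposite vertex 1, counting from 0.\<close>

definition simplex_C :: "int list list" where
  "simplex_C = [[0, 0, 0, 0, 1, 0, 0],
    [-1, -1, 0, -1, 0, 1, 2],
    [0, -1, 0, 0, 0, 0, 1],
    [0, 0, 0, 0, 0, 0, 0],
    [0, 0, 1, 0, 0, 0, 0],
    [0, -1, 0, 0, 0, 1, 1],
    [1, 0, 1, 0, 1, -1, -1],
    [0, -1, 0, -1, 0, 1, 2]]"

definition dual_A :: "int list list" where
  "dual_A = [[0, -1, 0, 0, 0, 1, 0, 0],
    [0, 0, 0, 0, 1, 0, -1, 1],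
    [0, 1, 1, 0, 0, 0, 1, 0],
    [1, 0, 0, -1, -1, -1, 0, -1],
    [0, -1, 0, 1, 0, 0, 0, 0],
    [0, 0, -1, 0, 1, 0, 0, 0],
    [0, 1, 0, 0, 0, 0, 0, 0],
    [0, 0, 0, 0, -1, 0, 0, 0]]"

definition dual_B :: "int list list" where
  "dual_B = [[0, -1, 0, 0, 0, 1, 0, 0],
    [0, 1, 1, 0, 1, 0, 0, 1],
    [0, -1, -1, 0, 0, 0, -1, 0],
    [1, 0, 0, -1, -1, -1, 0, -1],
    [0, -1, 0, 1, 0, 0, 0, 0],
    [0, 1, 0, 0, 1, 0, 1, 0],
    [0, 1, 0, 0, 0, 0, 0, 0],
    [0, 0, 0, 0, -1, 0, 0, 0]]"

definition dual_C :: "int list list" where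
  "dual_C = [[0, 0, 1, 0, 1, 1, 0, 1],
    [0, -1, -1, 0, -1, 0, 0, -1],
    [0, 0, 0, 0, 1, 0, -1, 1],
    [1, 0, 0, -1, -1, -1, 0, -1],
    [0, 0, 1, 1, 1, 0, 0, 1],
    [0, 0, -1, 0, 0, 0, 1, -1],
    [0, 0, -1, 0, -1, 0, 0, -1],
    [0, 1, 1, 0, 0, 0, 0, 1]]"

definition neighbours_A :: "(int list \<times> int list list \<times> nat list \<times> int \<times> int list) list" where
  "neighbours_A = [([1, 0, 0, 0, 0, 0, 0], simplex_A, [4, 1, 2, 3, 0, 5, 6], 1, [0, 0, 0, 0, 0, 0, 0]),
    ([0, 0, 0, -1, 0, 1, 1], simplex_A, [0, 1, 2, 5, 4, 3, 6], 1, [0, 0, 0, 0, 0, 0, 0]),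
    ([0, -1, 0, 0, 0, 0, 1], simplex_B, [0, 1, 2, 3, 4, 5, 6], 1, [0, 0, 0, 0, 0, 0, 0]),
    ([0, 0, 1, 0, 1, 0, 0], simplex_B, [3, 2, 1, 0, 5, 4, 6], -1, [0, 0, 0, 0, 0, 1, 1]),
    ([1, 0, 0, 0, 0, 0, 0], simplex_A, [2, 1, 0, 3, 4, 5, 6], 1, [0, 0, 0, 0, 0, 0, 0]),
    ([0, 0, 0, -1, 0, 1, 1], simplex_A, [0, 3, 2, 1, 4, 5, 6], 1, [0, 0, 0, 0, 0, 0, 0]),
    ([-1, -1, 0, -1, 0, 1, 2], simplex_A, [6, 1, 2, 3, 4, 5, 0], 1, [0, 0, 0, 0, 0, 0, 0]),
    ([1, 0, 1, 1, 1, -1, -1], simplex_A, [0, 1, 2, 6, 4, 5, 3], 1, [0, 0, 0, 0, 0, 0, 0])]"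

definition neighbours_B :: "(int list \<times> int list list \<times> nat list \<times> int \<times> int list) list" where
  "neighbours_B = [([1, 0, 0, 0, 0, 0, 0], simplex_B, [4, 1, 2, 3, 0, 5, 6], 1, [0, 0, 0, 0, 0, 0, 0]),
    ([-1, -1, 0, -1, 0, 1, 2], simplex_C, [0, 1, 2, 3, 4, 5, 6], 1, [0, 0, 0, 0, 0, 0, 0]),
    ([0, 0, 0, 0, 0, 1, 1], simplex_A, [0, 1, 2, 3, 4, 5, 6], 1, [0, 0, 0, 0, 0, 0, 0]),
    ([0, 0, 1, 0, 1, 0, 0], simplex_C, [3, 4, 0, 1, 6, 2, 5], 1, [0, -1, 0, 0, 0, 0, 1]),
    ([1, 0, 0, 0, 0, 0, 0], simplex_B, [2, 1, 0, 3, 4, 5, 6], 1, [0, 0, 0, 0, 0, 0, 0]),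
    ([-1, -1, 0, -1, 0, 1, 2], simplex_C, [0, 5, 2, 3, 4, 1, 6], 1, [0, 0, 0, 0, 0, 0, 0]),
    ([-1, -1, 0, -1, 0, 1, 2], simplex_B, [6, 1, 2, 3, 4, 5, 0], 1, [0, 0, 0, 0, 0, 0, 0]),
    ([1, 0, 1, 1, 1, -1, -1], simplex_B, [0, 1, 2, 6, 4, 5, 3], 1, [0, 0, 0, 0, 0, 0, 0])]"

definition neighbours_C :: "(int list \<times> int list list \<times> nat list \<times> int \<times> int list) list" where
  "neighbours_C = [([0, -1, 0, -1, 0, 1, 1], simplex_B, [4, 3, 6, 1, 0, 5, 2], -1, [0, -1, 0, -1, 0, 1, 2]),
    ([0, 0, 0, 0, 0, 0, 1], simplex_B, [0, 1, 2, 3, 4, 5, 6], 1, [0, 0, 0, 0, 0, 0, 0]),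
    ([0, -1, 0, -1, 0, 1, 1], simplex_C, [0, 1, 2, 5, 4, 3, 6], 1, [0, 0, 0, 0, 0, 0, 0]),
    ([0, 0, 1, 0, 1, 0, 0], simplex_B, [1, 0, 4, 3, 2, 6, 5], -1, [0, 0, 1, 0, 1, 0, 0]),
    ([0, -1, 0, -1, 0, 1, 1], simplex_B, [4, 3, 0, 5, 6, 1, 2], -1, [0, -1, 0, -1, 0, 1, 2]),
    ([0, 0, 0, 0, 0, 0, 1], simplex_C, [0, 5, 2, 3, 4, 1, 6], 1, [0, 0, 0, 0, 0, 0, 0]),
    ([0, 0, 0, 0, 0, 0, 1], simplex_B, [6, 5, 2, 3, 4, 1, 0], 1, [0, 0, 0, 0, 0, 0, 0]),
    ([0, 0, 1, 0, 1, -1, -1], simplex_B, [2, 3, 5, 0, 1, 6, 4], 1, [0, 0, 1, 0, 1, -1, -1])]"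

lemma dual_data_ABC: "dual_data simplex_A dual_A" "dual_data simplex_B dual_B" "dual_data simplex_C dual_C"
  by code_simp+

lemma neighbour_data_A: "\<forall>i<8. neighbour_data simplex_A dual_A i (neighbours_A ! i)"
  by code_simp

lemma neighbour_data_B: "\<forall>i<8. neighbour_data simplex_B dual_B i (neighbours_B ! i)"
  by code_simp

lemma neighbour_data_C: "\<forall>i<8. neighbour_data simplex_C dual_C i (neighbours_C ! i)"
  by code_simp

text \<open>
  The circumcentres are 1/22 times the given integer vectors, so that the squared circumradius is
  the right-hand side divided by \<open>9 * 22\<^sup>2 = 4356\<close>.
\<close>

lemma circumcentres:
  "\<forall>j<8. norm9 (map (\<lambda>k. 22 * simplex_A ! j ! k - [4, -6, 6, -4, 6, 5, 11] ! k) [0..<7]) = 32670"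
  "\<forall>j<8. norm9 (map (\<lambda>k. 22 * simplex_B ! j ! k - [2, -8, 6, -4, 6, 4, 12] ! k) [0..<7]) = 32472"
  "\<forall>j<8. norm9 (map (\<lambda>k. 22 * simplex_C ! j ! k - [0, -10, 6, -6, 6, 5, 13] ! k) [0..<7]) = 32670"
  by code_simp+

text \<open>The right side differs from \<open>Q7c\<close> by an affine function and vanishes at the
  vertices, so it is the power.\<close>

lemma circumsphere:
  assumes d: "dual_data W B"
    and c: "\<forall>j<8. norm9 (map (\<lambda>k. 22 * W ! j ! k - C ! k) [0..<7]) = r"
  shows "sphere_power Q7c (vertices W) x = quad_form Q7c (x - (1/22) *\<^sub>R ivec C) - of_int r / 4356"
proof -
  define c where "c = (1/22) *\<^sub>R ivec C"
  have scale: "ivec (W ! j) - c = (1/22) *\<^sub>R ivec (map (\<lambda>k. 22 * W ! j ! k - C ! k) [0..<7])" for j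
    by (rule vec_eq_coordI) (simp add: c_def field_simps)
  have "quad_form Q7c (x - c) - of_int r / 4356 = sphere_power Q7c (vertices W) x"
  proof (rule sphere_power_eqI[OF frame_vertices[OF d]])
    have "affine_fun (\<lambda>x. (- 1) * (quad_form Q7c (x + - c) - quad_form Q7c x) + of_int r / 4356)"
      by (intro affine_fun_add affine_fun_cmult affine_fun_quad_form_translate affine_fun_const transpose_Q7c)
    then show "affine_fun (\<lambda>x. quad_form Q7c x - (quad_form Q7c (x - c) - of_int r / 4356))"
      by (simp add: algebra_simps)
  next
    fix w assume "w \<in> vertices W"
    then obtain j where "j < 8" "w = ivec (W ! j)" unfolding vertices_def by auto
    then show "quad_form Q7c (w - c) - of_int r / 4356 = 0"
      using c by (simp add: scale quad_form_scaleR quad_form_ivec power2_eq_square)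
  qed
  then show ?thesis by (simp add: c_def)
qed

section \<open>The Delone subdivision of \<open>Q7c\<close>\<close>

definition base_simplices :: "(real^7) set set" where
  "base_simplices = {vertices simplex_A, vertices simplex_B, vertices simplex_C}"

definition Q7c_simplices :: "(real^7) set set" where
  "Q7c_simplices = (\<lambda>(g, W). g ` W) ` (symmetries \<times> base_simplices)"

lemma frame_base: "W \<in> base_simplices \<Longrightarrow> frame W"
  unfolding base_simplices_def using dual_data_ABC frame_vertices by blast

lemma id_symmetries: "(\<lambda>x. x) \<in> symmetries"
proof -
  have "act id 1 = (\<lambda>x. x)" by (rule ext) simp
  then show ?thesis using act_symmetries[of id] by simp
qed

lemma base_simplices_subset: "base_simplices \<subseteq> Q7c_simplices"
proof
  fix W assume "W \<in> base_simplices"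
  then have "(\<lambda>(g, W). g ` W) ((\<lambda>x. x), W) \<in> Q7c_simplices"
    unfolding Q7c_simplices_def using id_symmetries by (intro imageI) auto
  then show "W \<in> Q7c_simplices" by simp
qed

lemma vertices_int_lattice: "vertices W \<subseteq> int_lattice"
  unfolding vertices_def using ivec_int_lattice by blast

lemma bary_base_Ints:
  assumes "W \<in> base_simplices" "w \<in> W" "v \<in> int_lattice"
  shows "bary W w v \<in> \<int>"
proof -
  obtain S B where S: "W = vertices S" "dual_data S B"
    using assms(1) dual_data_ABC unfolding base_simplices_def by blast
  then obtain j where "j < 8" "w = ivec (S ! j)" using assms(2) unfolding vertices_def by auto
  then show ?thesis using affine_eval_Ints[OF assms(3)] by (simp add: S bary_vertices[OF S(2)])
qed

interpretation Q7c: unimodular_frames Q7c_simplices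
proof
  show "finite Q7c_simplices" 
    unfolding Q7c_simplices_def base_simplices_def using finite_symmetries by simp
  show "Q7c_simplices \<noteq> {}" using base_simplices_subset by (auto simp: base_simplices_def)
next
  fix W assume "W \<in> Q7c_simplices"
  then obtain g V where g: "g \<in> symmetries" "V \<in> base_simplices" "W = g ` V"
    unfolding Q7c_simplices_def by auto
  show "frame W" unfolding g(3) by (rule sphere_power_symmetries(1)[OF g(1) frame_base[OF g(2)]])
  show "W \<subseteq> int_lattice"
    using g vertices_int_lattice symmetries_int_lattice[OF g(1)] by (auto simp: base_simplices_def)
  fix w v :: "real^7" assume w: "w \<in> W" and v: "v \<in> int_lattice"
  then obtain w' where w': "w' \<in> V" "w = g w'" using g(3) by blast
  obtain h where h: "h \<in> symmetries" "\<And>x. g (h x) = x" using symmetries_inverse[OF g(1)] by metis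
  have "bary W w (g (h v)) = bary V w' (h v)"
    unfolding g(3) w'(2) by (rule sphere_power_symmetries(2)[OF g(1) frame_base[OF g(2)] w'(1)])
  also have "\<dots> \<in> \<int>" by (rule bary_base_Ints[OF g(2) w'(1) symmetries_int_lattice[OF h(1) v]])
  finally show "bary W w v \<in> \<int>" by (simp add: h(2))
qed

lemma base_neighbour:
  assumes "W \<in> base_simplices" "w \<in> W"
  shows "\<exists>u\<in>int_lattice. \<exists>V\<in>base_simplices. \<exists>g\<in>symmetries. \<exists>t\<in>int_lattice.
    insert u (W - {w}) = (+) t ` g ` V \<and> bary W w u < 0 \<and> sphere_power Q7c W u > 0"
proof -
  have gen: ?thesis if S: "W = vertices S" "dual_data S B" "length S = 8"
      "\<forall>i<8. neighbour_data S B i (N ! i)" and N: "length N = 8" 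
      "\<forall>(u, S', p, \<epsilon>, t)\<in>set N. vertices S' \<in> base_simplices" for S B N
  proof -
    obtain i where i: "i < 8" "w = ivec (S ! i)" using assms(2) S(1) unfolding vertices_def by auto
    obtain u S' p \<epsilon> t where n: "N ! i = (u, S', p, \<epsilon>, t)" using prod_cases5 by blast
    then have "(u, S', p, \<epsilon>, t) \<in> set N" using i(1) N(1) by (metis nth_mem)
    then have S': "vertices S' \<in> base_simplices" using N(2) by blast
    have "neighbour_data S B i (u, S', p, \<epsilon>, t)" using S(4) i(1) n by metis
    note nb = neighbour[OF S(2) i(1) _ this, unfolded S(3), OF i(1)]
    then obtain g where "g \<in> symmetries" "insert (ivec u) (W - {w}) = (+) (ivec t) ` g ` vertices S'"
      unfolding S(1) i(2) by blast
    then show ?thesis using nb(2,3) S' ivec_int_lattice unfolding S(1) i(2) by blast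
  qed
  consider "W = vertices simplex_A" | "W = vertices simplex_B" | "W = vertices simplex_C"
    using assms(1) unfolding base_simplices_def by blast
  then show ?thesis
  proof cases
    case 1 show ?thesis
      by (rule gen[OF 1 dual_data_ABC(1) _ neighbour_data_A]) 
         (simp_all add: simplex_A_def neighbours_A_def base_simplices_def)
  next
    case 2 show ?thesis
      by (rule gen[OF 2 dual_data_ABC(2) _ neighbour_data_B]) 
         (simp_all add: simplex_B_def neighbours_B_def base_simplices_def)
  next
    case 3 show ?thesis
      by (rule gen[OF 3 dual_data_ABC(3) _ neighbour_data_C]) 
         (simp_all add: simplex_C_def neighbours_C_def base_simplices_def)
  qed
qed

lemma locally_Delone_Q7c: "Q7c.locally_Delone Q7c"
  unfolding Q7c.locally_Delone_def
proof (intro ballI)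
  fix W w assume W: "W \<in> Q7c_simplices" and w: "w \<in> W"
  then obtain g V where g: "g \<in> symmetries" "V \<in> base_simplices" "W = g ` V"
    unfolding Q7c_simplices_def by auto
  then obtain w' where w': "w' \<in> V" "w = g w'" using w by blast
  obtain u V' h t where u: "u \<in> int_lattice" "V' \<in> base_simplices" "h \<in> symmetries" "t \<in> int_lattice"
      "insert u (V - {w'}) = (+) t ` h ` V'" "bary V w' u < 0" "sphere_power Q7c V u > 0"
    using base_neighbour[OF g(2) w'(1)] by blast
  have "inj g" using symmetries_inverse[OF g(1)] by (metis injI)
  then have "insert (g u) (W - {w}) = g ` insert u (V - {w'})"
    unfolding g(3) w'(2) by (simp add: image_set_diff)
  also have "\<dots> = (+) (g t) ` ((\<lambda>x. g (h x)) ` V')"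
    unfolding u(5) by (simp add: image_image linear_add[OF symmetries_linear[OF g(1)]])
  finally have e: "insert (g u) (W - {w}) = (+) (g t) ` ((\<lambda>x. g (h x)) ` V')" .
  have "(\<lambda>(g, W). g ` W) (\<lambda>x. g (h x), V') \<in> Q7c_simplices"
    unfolding Q7c_simplices_def using u(2) symmetries_compose[OF g(1) u(3)] by (intro imageI) auto
  then have "insert (g u) (W - {w}) \<in> Q7c.translates"
    unfolding e using symmetries_int_lattice[OF g(1) u(4)] 
    by (intro Q7c.translates_translate Q7c.R_translates) auto
  moreover have "bary W w (g u) < 0" "sphere_power Q7c W (g u) > 0"
    using sphere_power_symmetries(2,3)[OF g(1) frame_base[OF g(2)]] w' u(6,7) by (simp_all add: g(3))
  ultimately show "\<exists>u\<in>int_lattice. insert u (W - {w}) \<in> Q7c.translates \<and> bary W w u < 0 \<and> 0 < sphere_power Q7c W u"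
    using symmetries_int_lattice[OF g(1) u(1)] by blast
qed

text \<open>A and C have squared circumradius \<open>32670 / 4356 = 15 / 2\<close>, while B has the
  smaller value \<open>82 / 11\<close>. The circumcentre of A gives the lower bound.\<close>

lemma inhom_min_Q7c: "inhom_min Q7c = 15 / 2"
proof (rule antisym)
  show "inhom_min Q7c \<le> 15 / 2"
  proof (rule Q7c.inhom_min_le[OF pqf_Q7c locally_Delone_Q7c])
    fix W x assume "W \<in> Q7c_simplices"
    then obtain g V where g: "g \<in> symmetries" "V \<in> base_simplices" "W = g ` V"
      unfolding Q7c_simplices_def by auto
    obtain h where h: "\<And>x. g (h x) = x" using symmetries_inverse[OF g(1)] by metis
    have "sphere_power Q7c W (g (h x)) = sphere_power Q7c V (h x)"
      unfolding g(3) by (rule sphere_power_symmetries(3)[OF g(1) frame_base[OF g(2)]])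
    moreover have "- sphere_power Q7c V y \<le> 15 / 2" for y
    proof -
      obtain S B C r where "V = vertices S" "dual_data S B" "r \<le> 32670"
          "\<forall>j<8. norm9 (map (\<lambda>k. 22 * S ! j ! k - C ! k) [0..<7]) = r"
      proof -
        consider "V = vertices simplex_A" | "V = vertices simplex_B" | "V = vertices simplex_C"
          using g(2) unfolding base_simplices_def by blast
        then show ?thesis
          by cases (rule that[OF _ dual_data_ABC(1) _ circumcentres(1)] 
              that[OF _ dual_data_ABC(2) _ circumcentres(2)]
              that[OF _ dual_data_ABC(3) _ circumcentres(3)]; simp)+
      qed
      then have "- sphere_power Q7c V y = of_int r / 4356 - quad_form Q7c (y - (1/22) *\<^sub>R ivec C)"
        using circumsphere[of S B C r y] by simp
      also have "\<dots> \<le> of_int r / 4356" using pqf_nonneg[OF pqf_Q7c] by simp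
      also have "\<dots> \<le> 32670 / 4356" using \<open>r \<le> 32670\<close> by (intro divide_right_mono) auto
      finally show ?thesis by simp
    qed
    ultimately show "- sphere_power Q7c W x \<le> 15 / 2" by (simp add: h)
  qed
next
  have "vertices simplex_A \<in> Q7c.translates"
    using base_simplices_subset by (intro Q7c.R_translates) (auto simp: base_simplices_def)
  from Q7c.sphere_power_le_inhom_min[OF pqf_Q7c locally_Delone_Q7c this, of "(1/22) *\<^sub>R ivec [4, -6, 6, -4, 6, 5, 11]"]
  show "15 / 2 \<le> inhom_min Q7c"
    by (simp add: circumsphere[OF dual_data_ABC(1) circumcentres(1)])
qed

section \<open>Local optimality\<close>

lemma permutes_two_points:
  assumes "i \<noteq> j" "i' \<noteq> j'"
  obtains \<tau> where "\<tau> permutes UNIV" "\<tau> i = i'" "\<tau> j = j'"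
proof -
  let ?s = "Transposition.transpose i i'"
  define \<tau> where "\<tau> = Transposition.transpose (?s j) j' \<circ> ?s"
  have "?s j \<noteq> i'" using assms(1) by (metis transpose_apply_first transpose_eq_imp_eq)
  then have "\<tau> i = i'" "\<tau> j = j'" using assms(2) by (simp_all add: \<tau>_def)
  moreover have "\<tau> permutes UNIV" unfolding \<tau>_def by (intro permutes_compose permutes_swap_id) auto
  ultimately show ?thesis using that by blast
qed

text \<open>By invariance \<open>N i j\<close> takes one value \<open>a\<close> on the diagonal and
  one value \<open>b\<close> off it. Summing over the diagonal and over all pairs determines them,
  with factors \<open>5040 / 7\<close> and \<open>5040 / 42\<close>.\<close>

lemma sum_quad_form_permute:
  fixes M :: "real^7^7"
  shows "(\<Sum>\<sigma> | \<sigma> permutes UNIV. quad_form M (permute \<sigma> y)) =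
    720 * (\<Sum>i\<in>UNIV. (y $ i)\<^sup>2) * (\<Sum>i\<in>UNIV. M $ i $ i) +
    120 * ((\<Sum>i\<in>UNIV. y $ i)\<^sup>2 - (\<Sum>i\<in>UNIV. (y $ i)\<^sup>2)) * 
      ((\<Sum>i\<in>UNIV. \<Sum>j\<in>UNIV. M $ i $ j) - (\<Sum>i\<in>UNIV. M $ i $ i))"
proof -
  let ?P = "{\<sigma>. \<sigma> permutes (UNIV :: 7 set)}"
  define N where "N i j = (\<Sum>\<sigma>\<in>?P. y $ \<sigma> i * y $ \<sigma> j)" for i j
  have card: "card ?P = 5040"
    using card_permutations[of "UNIV :: 7 set" 7] by (simp add: fact_numeral)
  have inv: "N (\<tau> i) (\<tau> j) = N i j" if "\<tau> permutes UNIV" for \<tau> i j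
    unfolding N_def
    using sum_permutations_compose_right[OF that, of "\<lambda>\<sigma>. y $ \<sigma> i * y $ \<sigma> j"] by simp
  define a where "a = N 1 1"
  define b where "b = N 1 2"
  have Na: "N i i = a" for i
    using inv[OF permutes_swap_id[of 1 UNIV i], of 1 1] by (simp add: a_def)
  have Nb: "N i j = b" if ij: "i \<noteq> j" for i j
  proof -
    have "(1::7) \<noteq> 2" by simp
    then obtain \<tau> where "\<tau> permutes UNIV" "\<tau> 1 = i" "\<tau> 2 = j" 
      using permutes_two_points[OF _ ij] by metis
    then show ?thesis using inv[of \<tau> 1 2] by (simp add: b_def)
  qed
  have N: "N i j = b + of_bool (i = j) * (a - b)" for i j using Na Nb by auto
  have re: "(\<Sum>i\<in>UNIV. f (\<sigma> i)) = (\<Sum>i\<in>UNIV. f i)" if "\<sigma> \<in> ?P" for \<sigma> and f :: "7 \<Rightarrow> real"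
    using that by (intro sum.reindex_bij_betw permutes_bij) auto
  have "7 * a = (\<Sum>i\<in>UNIV. N i i)" by (simp add: Na)
  also have "\<dots> = (\<Sum>\<sigma>\<in>?P. \<Sum>i\<in>UNIV. (y $ \<sigma> i)\<^sup>2)"
    unfolding N_def by (subst sum.swap) (simp add: power2_eq_square)
  also have "\<dots> = (\<Sum>\<sigma>\<in>?P. \<Sum>i\<in>UNIV. (y $ i)\<^sup>2)"
    by (intro sum.cong re[of _ "\<lambda>i. (y $ i)\<^sup>2"] refl)
  finally have a: "a = 720 * (\<Sum>i\<in>UNIV. (y $ i)\<^sup>2)" by (simp add: card)
  have "7 * a + 42 * b = (\<Sum>i\<in>UNIV. \<Sum>j\<in>UNIV. N i j)"
    unfolding N by (simp add: sum.distrib)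
  also have "\<dots> = (\<Sum>\<sigma>\<in>?P. (\<Sum>i\<in>UNIV. y $ \<sigma> i)\<^sup>2)"
    unfolding N_def power2_eq_square sum_product 
    by (subst sum.swap, subst (2) sum.swap) (rule refl)
  also have "\<dots> = (\<Sum>\<sigma>\<in>?P. (\<Sum>i\<in>UNIV. y $ i)\<^sup>2)"
    by (intro sum.cong arg_cong[of _ _ "\<lambda>x. x\<^sup>2"] re[of _ "\<lambda>i. y $ i"] refl)
  finally have b: "b = 120 * ((\<Sum>i\<in>UNIV. y $ i)\<^sup>2 - (\<Sum>i\<in>UNIV. (y $ i)\<^sup>2))" using a by (simp add: card)
  have "(\<Sum>\<sigma>\<in>?P. quad_form M (permute \<sigma> y)) = (\<Sum>i\<in>UNIV. \<Sum>j\<in>UNIV. M $ i $ j * N i j)"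
    unfolding N_def quad_form_sum permute_def sum_distrib_left
    by (subst sum.swap, rule sum.cong[OF refl], subst sum.swap) simp
  also have "\<dots> = b * (\<Sum>i\<in>UNIV. \<Sum>j\<in>UNIV. M $ i $ j) + (a - b) * (\<Sum>i\<in>UNIV. M $ i $ i)"
  proof -
    have "M $ i $ j * N i j = b * M $ i $ j + (if i = j then (a - b) * M $ i $ j else 0)" for i j
      by (simp add: N algebra_simps)
    then show ?thesis by (simp add: sum.distrib sum_distrib_left)
  qed
  also have "\<dots> = a * (\<Sum>i\<in>UNIV. M $ i $ i) + b * ((\<Sum>i\<in>UNIV. \<Sum>j\<in>UNIV. M $ i $ j) - (\<Sum>i\<in>UNIV. M $ i $ i))"
    by (simp add: algebra_simps)
  finally show ?thesis unfolding a b by simp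
qed

text \<open>The matrix of \<open>Q\<close> in the coordinates \<open>to_frame\<close>; for
  \<open>Q7c\<close> it is \<open>(11 I + J) / 9\<close>.\<close>

definition frame_gram :: "real^7^7 \<Rightarrow> real^7^7" where
  "frame_gram Q = transpose (matrix of_frame) ** Q ** matrix of_frame"

lemma quad_form_frame_gram: "quad_form (frame_gram Q) x = quad_form Q (of_frame x)"
  by (simp add: frame_gram_def quad_form_congruence fun_cong[OF matrix_vector_mul(2)[OF linear_of_frame]])

text \<open>
  \<open>s1\<close> and \<open>s2\<close> are \<open>22\<^sup>3 = 10648\<close> times \<open>\<Sum>\<^sub>w \<lambda>\<^sub>w \<bar>y\<^sub>w\<bar>\<^sup>2\<close> and \<open>\<Sum>\<^sub>w \<lambda>\<^sub>w (\<Sum>\<^sub>i y\<^sub>w\<^sub>i)\<^sup>2\<close>, where \<open>y\<^sub>w = to_frame (w - c)\<close>: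
  the only data of the simplex that survive averaging over all permutations.
\<close>

lemma inhom_min_moment:
  assumes Q: "pqf Q" "Q7c.locally_Delone Q" and S: "vertices S \<in> base_simplices" "dual_data S B"
    and s1: "(\<Sum>j<8. (21 * B ! j ! 0 + affine_eval_int (B ! j) C) * 
       (\<Sum>k<7. (to_frame_int (map (\<lambda>k. 22 * S ! j ! k - C ! k) [0..<7]) ! k)\<^sup>2)) = s1"
    and s2: "(\<Sum>j<8. (21 * B ! j ! 0 + affine_eval_int (B ! j) C) * 
       (\<Sum>k<7. to_frame_int (map (\<lambda>k. 22 * S ! j ! k - C ! k) [0..<7]) ! k)\<^sup>2) = s2"
  defines "D \<equiv> \<Sum>i\<in>UNIV. frame_gram Q $ i $ i" and "E \<equiv> \<Sum>i\<in>UNIV. \<Sum>j\<in>UNIV. frame_gram Q $ i $ j"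
  shows "of_int s1 * D / 7 + of_int (s2 - s1) * (E - D) / 42 \<le> 10648 * inhom_min Q"
proof -
  let ?P = "{\<sigma>. \<sigma> permutes (UNIV :: 7 set)}"
  let ?W = "vertices S" and ?c = "(1/22) *\<^sub>R ivec C"
  define Z where "Z j = to_frame_int (map (\<lambda>k. 22 * S ! j ! k - C ! k) [0..<7])" for j
  \<comment> \<open>This is 22 times the barycentric coordinate of \<open>C / 22\<close>:
    \<open>affine_eval_int\<close> counts the constant term once, and 21 more copies are
    required.\<close>
  define L where "L j = 21 * B ! j ! 0 + affine_eval_int (B ! j) C" for j
  have L: "affine_eval (B ! j) ?c = of_int (L j) / 22" for j
    by (simp add: affine_eval_def L_def affine_eval_int_def add_divide_distrib sum_divide_distrib mult.commute)
  have sub: "ivec (S ! j) - ?c = (1/22) *\<^sub>R ivec (map (\<lambda>k. 22 * S ! j ! k - C ! k) [0..<7])" for j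
    by (rule vec_eq_coordI) (simp add: field_simps)
  have Z: "to_frame (ivec (S ! j) - ?c) = (1/22) *\<^sub>R ivec (Z j)" for j
    unfolding sub linear_scale[OF linear_to_frame] to_frame_ivec Z_def ..
  define p where "p j = (\<Sum>k<7. (real_of_int (Z j ! k))\<^sup>2)" for j
  define q where "q j = (\<Sum>k<7. real_of_int (Z j ! k))\<^sup>2" for j
  have card: "card ?P = 5040"
    using card_permutations[of "UNIV :: 7 set" 7] by (simp add: fact_numeral)
  \<comment> \<open>The bound for the image of the simplex under \<open>\<sigma>\<close>, taken at
    the image of the point \<open>C / 22\<close>; averaging over all \<open>\<sigma>\<close>
    follows.\<close>
  have *: "(\<Sum>j<8. of_int (L j) / 22 * quad_form (frame_gram Q) (permute \<sigma> ((1/22) *\<^sub>R ivec (Z j)))) \<le> inhom_min Q"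
    if \<sigma>: "\<sigma> \<in> ?P" for \<sigma>
  proof -
    define g where "g = act \<sigma> 1"
    have g: "g \<in> symmetries" using \<sigma> act_symmetries permutes_bij unfolding g_def by blast
    note lin = symmetries_linear[OF g]
    have F: "frame ?W" by (rule frame_vertices[OF S(2)])
    have "(\<lambda>(g, W). g ` W) (g, ?W) \<in> Q7c_simplices" 
      unfolding Q7c_simplices_def using g S(1) by (intro imageI) auto
    then have gW: "g ` ?W \<in> Q7c.translates" by (intro Q7c.R_translates) simp
    have inj: "inj_on g ?W" using symmetries_inverse[OF g] by (metis inj_onI)
    have "(\<Sum>v\<in>g ` ?W. bary (g ` ?W) v (g ?c) * quad_form Q (v - g ?c)) = - sphere_power Q (g ` ?W) (g ?c)"
      by (rule sum_bary_quad_form[OF pqf_sym[OF Q(1)] sphere_power_symmetries(1)[OF g F]])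
    moreover have "(\<Sum>v\<in>g ` ?W. bary (g ` ?W) v (g ?c) * quad_form Q (v - g ?c)) =
        (\<Sum>v\<in>?W. bary ?W v ?c * quad_form Q (g (v - ?c)))"
      by (simp only: sum.reindex[OF inj] o_def linear_diff[OF lin])
         (intro sum.cong refl, simp add: sphere_power_symmetries(2)[OF g F])
    moreover have "\<dots> = (\<Sum>j<8. of_int (L j) / 22 * quad_form Q (g (ivec (S ! j) - ?c)))"
      by (subst vertices_def, subst sum.reindex[OF inj_vertices[OF S(2)]])
         (simp add: bary_vertices[OF S(2)] L del: scaleR_diff_right)
    moreover have "quad_form Q (g (ivec (S ! j) - ?c)) = quad_form (frame_gram Q) (permute \<sigma> ((1/22) *\<^sub>R ivec (Z j)))" for j
      by (simp only: g_def act_def Z quad_form_frame_gram scaleR_one)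
    ultimately show ?thesis
      using Q7c.sphere_power_le_inhom_min[OF Q gW, of "g ?c"] by simp
  qed
  have "(\<Sum>\<sigma>\<in>?P. \<Sum>j<8. of_int (L j) / 22 * quad_form (frame_gram Q) (permute \<sigma> ((1/22) *\<^sub>R ivec (Z j)))) 
     \<le> (\<Sum>\<sigma>\<in>?P. inhom_min Q)"
    by (rule sum_mono) (rule *)
  also have "(\<Sum>\<sigma>\<in>?P. \<Sum>j<8. of_int (L j) / 22 * quad_form (frame_gram Q) (permute \<sigma> ((1/22) *\<^sub>R ivec (Z j)))) =
     (\<Sum>j<8. of_int (L j) / 22 * (\<Sum>\<sigma>\<in>?P. quad_form (frame_gram Q) (permute \<sigma> ((1/22) *\<^sub>R ivec (Z j)))))"
    by (subst sum.swap) (simp add: sum_distrib_left)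
  also have "\<dots> = (\<Sum>j<8. of_int (L j) * p j) / 10648 * (720 * D) +
     ((\<Sum>j<8. of_int (L j) * q j) - (\<Sum>j<8. of_int (L j) * p j)) / 10648 * (120 * (E - D))"
  proof -
    have "of_int (L j) / 22 * (\<Sum>\<sigma>\<in>?P. quad_form (frame_gram Q) (permute \<sigma> ((1/22) *\<^sub>R ivec (Z j)))) =
      of_int (L j) * p j * (720 * D / 10648) + (of_int (L j) * q j - of_int (L j) * p j) * (120 * (E - D) / 10648)" for j
    proof -
      have e: "(\<Sum>i\<in>UNIV. (((1/22) *\<^sub>R ivec (Z j)) $ i)\<^sup>2) = p j / 484"
        "(\<Sum>i\<in>UNIV. ((1/22) *\<^sub>R ivec (Z j)) $ i) = (\<Sum>k<7. of_int (Z j ! k)) / 22"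
        unfolding sum_coord p_def by (simp_all add: power_divide sum_divide_distrib)
      show ?thesis
        unfolding sum_quad_form_permute D_def[symmetric] E_def[symmetric] e
        by (simp add: power_divide q_def field_simps)
    qed
    then show ?thesis by (simp only: sum.distrib sum_subtractf flip: sum_distrib_right)
  qed
  also have "(\<Sum>j<8. of_int (L j) * p j) = real_of_int s1"
    unfolding s1[symmetric] Z_def L_def p_def by simp
  also have "(\<Sum>j<8. of_int (L j) * q j) = real_of_int s2"
    unfolding s2[symmetric] Z_def L_def q_def by simp
  finally show ?thesis by (simp add: card field_simps)
qed

lemma inhom_min_trace:
  assumes Q: "pqf Q" "Q7c.locally_Delone Q"
  shows "15 * (18 * (\<Sum>i\<in>UNIV. frame_gram Q $ i $ i) - (\<Sum>i\<in>UNIV. \<Sum>j\<in>UNIV. frame_gram Q $ i $ j)) / 308 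
    \<le> inhom_min Q"
proof -
  let ?D = "\<Sum>i\<in>UNIV. frame_gram Q $ i $ i" and ?E = "\<Sum>i\<in>UNIV. \<Sum>j\<in>UNIV. frame_gram Q $ i $ j"
  have A: "of_int 61226 * ?D / 7 + of_int (45254 - 61226) * (?E - ?D) / 42 \<le> 10648 * inhom_min Q"
    by (rule inhom_min_moment[OF Q _ dual_data_ABC(1), where C = "[4, -6, 6, -4, 6, 5, 11]"], simp add: base_simplices_def) code_simp+
  have C: "of_int 63162 * ?D / 7 + of_int (23958 - 63162) * (?E - ?D) / 42 \<le> 10648 * inhom_min Q"
    by (rule inhom_min_moment[OF Q _ dual_data_ABC(3), where C = "[0, -10, 6, -6, 6, 5, 13]"], simp add: base_simplices_def) code_simp+
  \<comment> \<open>Weights 3/4 and 1/4 combine the coefficients of the two sums to the ratio 18 to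
    -1, as in the inverse \<open>(18 I - J) / 22\<close> of the Gram matrix of
    \<open>Q7c\<close>.\<close>
  show ?thesis using A C by (simp add: field_simps)
qed

text \<open>
  The Gram-Schmidt vectors of the basis \<open>e\<^sub>1, \<dots>, e\<^sub>7\<close>, cleared of denominators. The constant 404323920
  below is the least common multiple of their values of \<open>norm9\<close>.
\<close>

definition orth_basis :: "int list list" where
  "orth_basis = [[11, 0, 0, 0, 0, 0, 0],
    [-1, 12, 0, 0, 0, 0, 0],
    [-1, -1, 13, 0, 0, 0, 0],
    [-1, -1, -1, 14, 0, 0, 0],
    [-1, -1, -1, -1, 15, 0, 0],
    [-1, -1, -1, -1, -1, 16, 0],
    [-6, -6, -6, -6, -6, 11, 17]]"

definition orth_matrix :: "real^7^7" where
  "orth_matrix = (\<chi> i j. of_int (orth_basis ! index j ! index i))"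

lemma orth_matrix_axis: "orth_matrix *v axis j 1 = ivec (orth_basis ! index j)"
  by (simp add: matrix_vector_mult_basis column_def orth_matrix_def ivec_def)

lemma orth_basis_upper: "\<forall>i<7. \<forall>j<i. orth_basis ! j ! i = 0"
  by code_simp

lemma orth_basis_orthogonal:
  "\<forall>i<7. \<forall>j<7. i \<noteq> j \<longrightarrow> 11 * (\<Sum>k<7. to_frame_int (orth_basis ! i) ! k * to_frame_int (orth_basis ! j) ! k) +
     (\<Sum>k<7. to_frame_int (orth_basis ! i) ! k) * (\<Sum>k<7. to_frame_int (orth_basis ! j) ! k) = 0"
  by code_simp

text \<open>For an orthogonal basis, the sum of \<open>z z^T / Q7c[z]\<close> is the inverse Gram
  matrix, here \<open>(18 I - J) / 22\<close>, cleared of denominators: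
  \<open>2042040 = 404323920 / (9 * 22)\<close>.\<close>

lemma orth_basis_trace:
  "\<forall>a<7. \<forall>b<7. (\<Sum>j<7. to_frame_int (orth_basis ! j) ! a * to_frame_int (orth_basis ! j) ! b * (404323920 div norm9 (orth_basis ! j)))
     = 2042040 * (18 * of_bool (a = b) - 1)"
  by code_simp

lemma norm9_orth_basis: "\<forall>j<7. norm9 (orth_basis ! j) dvd 404323920 \<and> norm9 (orth_basis ! j) > 0"
  by code_simp

lemma det_orth_matrix: "det orth_matrix = 11 * 12 * 13 * 14 * 15 * 16 * 17"
proof -
  have "inj index" by (metis coord_index injI)
  then have "det orth_matrix = (\<Prod>i\<in>UNIV. orth_matrix $ i $ i)"
    using orth_basis_upper by (intro det_triangular) (auto simp: orth_matrix_def)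
  also have "\<dots> = (\<Prod>k<7. of_int (orth_basis ! k ! k))" 
    unfolding prod_coord by (simp add: orth_matrix_def)
  also have "\<dots> = of_int (\<Prod>k<7. orth_basis ! k ! k)" by simp
  also have "(\<Prod>k<7. orth_basis ! k ! k) = 11 * 12 * 13 * 14 * 15 * 16 * 17" by code_simp
  finally show ?thesis by simp
qed

lemma orth_matrix_orthogonal:
  assumes "i \<noteq> j" shows "(transpose orth_matrix ** Q7c ** orth_matrix) $ i $ j = 0"
proof -
  have "index i \<noteq> index j" using assms by (metis coord_index)
  then have "of_int (11 * (\<Sum>k<7. to_frame_int (orth_basis ! index i) ! k * to_frame_int (orth_basis ! index j) ! k) +
     (\<Sum>k<7. to_frame_int (orth_basis ! index i) ! k) * (\<Sum>k<7. to_frame_int (orth_basis ! index j) ! k)) = (0::real)"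
    using orth_basis_orthogonal by simp
  then show ?thesis
    unfolding matrix_congruence_entry orth_matrix_axis inner_Q7c to_frame_ivec
    by (simp add: inner_vec_def sum_coord)
qed

lemma det_Q7c: "det Q7c = 2 * 11 ^ 6"
proof -
  have "det (transpose orth_matrix ** Q7c ** orth_matrix) = 
      (\<Prod>i\<in>UNIV. (transpose orth_matrix ** Q7c ** orth_matrix) $ i $ i)"
    by (rule det_diagonal) (rule orth_matrix_orthogonal)
  also have "\<dots> = (\<Prod>k<7. of_int (norm9 (orth_basis ! k)) / 9)"
    unfolding prod_coord matrix_congruence_entry orth_matrix_axis
    by (simp flip: quad_form_def add: quad_form_ivec)
  also have "\<dots> = of_int (\<Prod>k<7. norm9 (orth_basis ! k)) / 9 ^ 7"
    by (simp add: prod_dividef)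
  \<comment> \<open>The squared factor is \<open>det orth_matrix\<close>, which cancels
    below.\<close>
  also have "(\<Prod>k<7. norm9 (orth_basis ! k)) = 9 ^ 7 * (2 * 11 ^ 6) * (11 * 12 * 13 * 14 * 15 * 16 * 17)^2"
    by code_simp
  finally have "det orth_matrix * det Q7c * det orth_matrix = 
     real_of_int (9 ^ 7 * (2 * 11 ^ 6) * (11 * 12 * 13 * 14 * 15 * 16 * 17)^2) / 9 ^ 7"
    by (simp only: det_mul det_transpose)
  then show ?thesis unfolding det_orth_matrix by simp
qed

text \<open>Both sides are the trace of \<open>Q Q7c^-1\<close>, on the right computed in frame
  coordinates.\<close>

lemma frame_gram_trace:
  "(\<Sum>i\<in>UNIV. quad_form Q (orth_matrix *v axis i 1) / quad_form Q7c (orth_matrix *v axis i 1)) =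
   (18 * (\<Sum>i\<in>UNIV. frame_gram Q $ i $ i) - (\<Sum>i\<in>UNIV. \<Sum>j\<in>UNIV. frame_gram Q $ i $ j)) / 22"
proof -
  let ?z = "\<lambda>j. to_frame_int (orth_basis ! j)"
  let ?m = "\<lambda>j. 404323920 div norm9 (orth_basis ! j)"
  let ?M = "frame_gram Q"
  have q: "quad_form Q v = quad_form ?M (to_frame v)" for v
    by (simp add: quad_form_frame_gram)
  have "(\<Sum>i\<in>UNIV. quad_form Q (orth_matrix *v axis i 1) / quad_form Q7c (orth_matrix *v axis i 1)) =
    (\<Sum>j<7. quad_form ?M (ivec (?z j)) / (of_int (norm9 (orth_basis ! j)) / 9))"
    unfolding sum_coord[of "\<lambda>i. quad_form _ (_ i) / _ i"] orth_matrix_axis by (simp add: q to_frame_ivec quad_form_ivec)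
  \<comment> \<open>The denominator is \<open>404323920 / 9\<close>; the integer divisions in
    \<open>?m\<close> are exact.\<close>
  also have "\<dots> = (\<Sum>j<7. quad_form ?M (ivec (?z j)) * of_int (?m j)) / 44924880"
    unfolding sum_divide_distrib
  proof (intro sum.cong refl)
    fix j :: nat assume "j \<in> {..<7}"
    then have "norm9 (orth_basis ! j) dvd 404323920" "norm9 (orth_basis ! j) > 0" using norm9_orth_basis by auto
    then have "real_of_int (?m j) = 404323920 / real_of_int (norm9 (orth_basis ! j))" 
      by (simp add: real_of_int_div)
    then show "quad_form ?M (ivec (?z j)) / (of_int (norm9 (orth_basis ! j)) / 9) =
        quad_form ?M (ivec (?z j)) * of_int (?m j) / 44924880" by simp
  qed
  also have "(\<Sum>j<7. quad_form ?M (ivec (?z j)) * of_int (?m j)) =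
     (\<Sum>j<7. \<Sum>a<7. \<Sum>b<7. ?M $ coord a $ coord b * of_int (?z j ! a * ?z j ! b * ?m j))"
    unfolding quad_form_sum sum_coord by (simp add: sum_distrib_right mult.assoc)
  also have "\<dots> = (\<Sum>a<7. \<Sum>b<7. ?M $ coord a $ coord b * of_int (\<Sum>j<7. ?z j ! a * ?z j ! b * ?m j))"
    unfolding of_int_sum sum_distrib_left by (subst sum.swap, rule sum.cong[OF refl], rule sum.swap)
  also have "\<dots> = (\<Sum>a<7. \<Sum>b<7. ?M $ coord a $ coord b * of_int (2042040 * (18 * of_bool (a = b) - 1)))"
    by (intro sum.cong refl) (use orth_basis_trace in \<open>simp only: lessThan_iff\<close>)
  also have "\<dots> = (\<Sum>a<7. \<Sum>b<7. 2042040 * 18 * (of_bool (a = b) * ?M $ coord a $ coord b) - 2042040 * ?M $ coord a $ coord b)"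
    by (intro sum.cong refl) auto
  also have "\<dots> = 2042040 * (18 * (\<Sum>i\<in>UNIV. ?M $ i $ i) - (\<Sum>i\<in>UNIV. \<Sum>j\<in>UNIV. ?M $ i $ j))"
    unfolding sum_coord by (simp add: sum_subtractf right_diff_distrib flip: sum_distrib_left)
  finally show ?thesis by simp
qed

text \<open>With \<open>T\<close> the normalized trace of \<open>Q Q7c^-1\<close>,
  \<open>det Q / det Q7c\<close> is at most \<open>T ^ 7\<close>, and \<open>15 / 2 * T\<close> is
  at most the inhomogeneous minimum.\<close>

lemma inhom_min_det:
  assumes Q: "pqf Q" "Q7c.locally_Delone Q"
  shows "(15 / 2) ^ 7 * (det Q / det Q7c) \<le> inhom_min Q ^ 7"
proof -
  define T where "T = (\<Sum>i\<in>UNIV. quad_form Q (orth_matrix *v axis i 1) / quad_form Q7c (orth_matrix *v axis i 1)) / 7"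
  have "det Q / det Q7c \<le> T ^ 7"
    using det_trace_inequality[OF pqf_Q7c Q(1), of orth_matrix] orth_matrix_orthogonal
    by (simp add: T_def det_orth_matrix)
  then have "(15 / 2) ^ 7 * (det Q / det Q7c) \<le> (15 / 2) ^ 7 * T ^ 7" by (intro mult_left_mono) auto
  also have "\<dots> = (15 / 2 * T) ^ 7" by (rule power_mult_distrib[symmetric])
  also have "\<dots> \<le> inhom_min Q ^ 7"
  proof (rule power_mono)
    show "15 / 2 * T \<le> inhom_min Q"
      using inhom_min_trace[OF Q] by (simp add: T_def frame_gram_trace)
    show "0 \<le> 15 / 2 * T"
      unfolding T_def using pqf_nonneg[OF Q(1)] pqf_nonneg[OF pqf_Q7c] by (simp add: sum_nonneg)
  qed
  finally show ?thesis .
qed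

lemma locally_optimal_Q7c: "locally_optimal_covering Q7c"
  unfolding locally_optimal_covering_def eventually_at_filter
proof (intro conjI pqf_Q7c)
  show "\<forall>\<^sub>F Q in nhds Q7c. Q \<noteq> Q7c \<longrightarrow> Q \<in> {Q. pqf Q} \<longrightarrow> covering_density Q7c \<le> covering_density Q"
    using Q7c.eventually_locally_Delone[OF locally_Delone_Q7c]
  proof eventually_elim
    case (elim Q)
    have "covering_density Q7c \<le> covering_density Q" if Q: "pqf Q"
    proof -
      have "inhom_min Q7c ^ 7 / det Q7c \<le> inhom_min Q ^ 7 / det Q"
        using inhom_min_det[OF Q elim] pqf_det_pos[OF Q] pqf_det_pos[OF pqf_Q7c]
        by (simp add: inhom_min_Q7c field_simps)
      then show ?thesis unfolding covering_density_def by (intro mult_right_mono) auto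
    qed
    then show ?case by simp
  qed
qed

section \<open>The numerical value of the covering density\<close>

lemma covering_density_Q7c:
  "covering_density Q7c = sqrt ((15 / 2) ^ 7 / (2 * 11 ^ 6)) * (16 / 105 * pi ^ 3)"
proof -
  have "unit_ball_vol (real (2 * 3 + 1)) = 16 / 105 * pi ^ 3"
    unfolding unit_ball_vol_odd by (simp add: fact_numeral)
  then have "measure lborel (cball (0 :: real^7) 1) = 16 / 105 * pi ^ 3"
    by (simp add: content_cball)
  then show ?thesis by (simp add: covering_density_def inhom_min_Q7c det_Q7c)
qed

lemma covering_density_Q7c_bounds:
  "2.900024 \<le> covering_density Q7c" "covering_density Q7c < 2.900025"
proof -
  have p: "3.14159265358 ^ 3 \<le> pi ^ 3" "pi ^ 3 \<le> 3.1415926536 ^ 3"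
    using pi_approx by (auto intro!: power_mono)
  have s: "0.6137922 \<le> sqrt ((15 / 2) ^ 7 / (2 * 11 ^ 6))"
    by (rule real_le_rsqrt) (simp add: power2_eq_square power_divide)
  have s': "sqrt ((15 / 2) ^ 7 / (2 * 11 ^ 6)) \<le> (0.61379221 :: real)"
    by (rule real_le_lsqrt) (simp_all add: power2_eq_square power_divide)
  have "2.900024 \<le> 0.6137922 * (16 / 105 * (3.14159265358 ^ 3 :: real))" by (simp add: power_divide)
  also have "\<dots> \<le> covering_density Q7c"
    unfolding covering_density_Q7c using p s by (intro mult_mono) auto
  finally show "2.900024 \<le> covering_density Q7c" .
  have "covering_density Q7c \<le> 0.61379221 * (16 / 105 * 3.1415926536 ^ 3)"
    unfolding covering_density_Q7c using p s' by (intro mult_mono) auto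
  also have "\<dots> < 2.900025" by (simp add: power_divide)
  finally show "covering_density Q7c < 2.900025" .
qed

theorem theorem11p11:
  shows "pqf Q7c
    \<and> locally_optimal_covering Q7c
    \<and> in_interior_of_secondary_cone Q7c
    \<and> inhom_min Q7c = 15 / 2
    \<and> det Q7c = 2 * 11 ^ 6
    \<and> 2.900024 \<le> covering_density Q7c \<and> covering_density Q7c < 2.900025"
  using pqf_Q7c locally_optimal_Q7c Q7c.in_interior_of_secondary_cone[OF pqf_Q7c locally_Delone_Q7c]
    inhom_min_Q7c det_Q7c covering_density_Q7c_bounds by blast

end
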